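(* Let $\chi$ be a real, non-principal, primitive Dirichlet character of conductor $q$, and let $\chi^*$ be a completely multiplicative function with $\chi^*(n)=\chi(n)$ whenever $\gcd(n,q)=1$ and $\chi^*(p)\in\{-1,1\}$ for every prime $p\mid q$. Let $f_1=\mu^2\chi^*$ and $f_2=\mu_2^2\chi^*$. For $f\in\{f_1,f_2\}$ and $H\in\mathbb{N}$ let $$\Lambda(H)=\lim_{x\to\infty}\frac{1}{x}\sum_{n\leq x}\Big|\sum_{k=n+1}^{n+H}f(k)\Big|^2.$$ Then for $f=f_1$ one has $\Lambda(H)\ll H^{1/2}$, and for $f=f_2$ one has $\Lambda(H)\ll H^{1/3}$.
   Context: $\mu$ is the Möbius function, so $\mu^2$ is the indicator of squarefree integers; $\mu_2^2$ is the indicator of cubefree integers (multiplicative with $\mu_2^2(p^k)=1$ for $k\le 2$ and $0$ for $k\ge 3$). $A\ll B$ means $|A|\le c B$ for some constant $c>0$ independent of $H$. *)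

theory Defs
  imports Complex_Main "HOL-Computational_Algebra.Computational_Algebra"
begin

text \<open>
  Dirichlet characters modulo \<open>q\<close>, as complex-valued functions on the natural numbers.
  The value 1 at 1 follows from multiplicativity and non-vanishing at 1.
\<close>

definition dirichlet_character :: "nat \<Rightarrow> (nat \<Rightarrow> complex) \<Rightarrow> bool" where
  "dirichlet_character q \<chi> \<longleftrightarrow> q > 0 \<and>
     (\<forall>m n. \<chi> (m * n) = \<chi> m * \<chi> n) \<and>
     (\<forall>n. \<chi> (n + q) = \<chi> n) \<and>
     (\<forall>n. \<chi> n \<noteq> 0 \<longleftrightarrow> coprime n q)"

definition principal_character :: "nat \<Rightarrow> (nat \<Rightarrow> complex) \<Rightarrow> bool" where
  "principal_character q \<chi> \<longleftrightarrow>
     dirichlet_character q \<chi> \<and> (\<forall>n. coprime n q \<longrightarrow> \<chi> n = 1)"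

definition induced_from :: "nat \<Rightarrow> (nat \<Rightarrow> complex) \<Rightarrow> nat \<Rightarrow> bool" where
  "induced_from q \<chi> d \<longleftrightarrow> d dvd q \<and>
     (\<exists>\<psi>. dirichlet_character d \<psi> \<and> (\<forall>n. coprime n q \<longrightarrow> \<chi> n = \<psi> n))"

text \<open>A primitive character modulo \<open>q\<close> is one whose conductor is \<open>q\<close> itself.\<close>

definition primitive_character :: "nat \<Rightarrow> (nat \<Rightarrow> complex) \<Rightarrow> bool" where
  "primitive_character q \<chi> \<longleftrightarrow>
     dirichlet_character q \<chi> \<and> (\<forall>d. induced_from q \<chi> d \<longrightarrow> d = q)"

text \<open>Arithmetic functions live on the positive integers, so the value at 0 is left free.\<close>

definition completely_multiplicative :: "(nat \<Rightarrow> complex) \<Rightarrow> bool" where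
  "completely_multiplicative g \<longleftrightarrow>
     g 1 = 1 \<and> (\<forall>m>0. \<forall>n>0. g (m * n) = g m * g n)"

definition moebius_mu :: "nat \<Rightarrow> int" where
  "moebius_mu n = (if squarefree n then (- 1) ^ card (prime_factors n) else 0)"

definition cubefree :: "nat \<Rightarrow> bool" where
  "cubefree n \<longleftrightarrow> (\<forall>p. prime p \<longrightarrow> \<not> p ^ 3 dvd n)"

definition f1 :: "(nat \<Rightarrow> complex) \<Rightarrow> nat \<Rightarrow> complex" where
  "f1 g n = of_int ((moebius_mu n)\<^sup>2) * g n"

definition f2 :: "(nat \<Rightarrow> complex) \<Rightarrow> nat \<Rightarrow> complex" where
  "f2 g n = of_bool (cubefree n) * g n"

definition window_mean :: "(nat \<Rightarrow> complex) \<Rightarrow> nat \<Rightarrow> real \<Rightarrow> real" where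
  "window_mean f H x =
     1 / x * (\<Sum>n = 1..nat \<lfloor>x\<rfloor>. (cmod (\<Sum>k = n + 1..n + H. f k))\<^sup>2)"

text \<open>
  The operator \<open>Lim\<close> carries no information when the limit does not exist;
  convergence has to be asserted separately.
\<close>

definition Lambda :: "(nat \<Rightarrow> complex) \<Rightarrow> nat \<Rightarrow> real" where
  "Lambda f H = Lim at_top (window_mean f H)"

end

theory Submission
  imports Defs "HOL-Number_Theory.Residues" "HOL-Analysis.Convex"
begin

text \<open>
  Let \<open>j\<close> be \<open>2\<close> or \<open>3\<close>. Up to a set of integers of density at most \<open>1 / Z\<close>, the \<open>j\<close>-free part of
  \<open>\<chi>*\<close> is a finite linear combination of the periodic functions
  \<open>k \<mapsto> 1[D | k] \<chi>(k / D)\<close> with \<open>D = r d\<^sup>j\<close>, where \<open>r | q\<^bsup>j - 1\<^esup>\<close> carries the primes dividing \<open>q\<close> and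
  \<open>d\<close>, coprime to \<open>q\<close>, comes from sieving by the primes up to \<open>Z\<close>. Periodicity gives the
  existence of the mean square, so it suffices to bound it for the combination, uniformly in \<open>Z\<close>.

  For \<open>D = G u\<close> and \<open>E = G v\<close> with \<open>u, v, q\<close> pairwise coprime, the window sums of the functions attached
  to \<open>D\<close> and \<open>E\<close> are conditionally independent given the residue of \<open>n\<close> modulo \<open>G q\<close>, with
  conditional means the window sum attached to \<open>G\<close> times a factor of modulus \<open>1 / u\<close>, respectively
  \<open>1 / v\<close>. Their correlation is thus \<open>O(min(1, H / G) / (u v))\<close>, because a non-principal character has
  bounded partial sums. Grouping the pairs \<open>(d, e)\<close> by \<open>g = gcd(d, e)\<close> leaves
  \<open>\<Sum>\<^sub>g min(1, H / g\<^sup>j) = O(H\<^bsup>1 / j\<^esup>)\<close>.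
\<close>

section \<open>Periodic functions and their means\<close>

definition periodic :: "nat \<Rightarrow> (nat \<Rightarrow> 'a) \<Rightarrow> bool" where
  "periodic N f \<longleftrightarrow> (\<forall>n. f (n + N) = f n)"

lemma periodic_add_mult:
  assumes "periodic N f"
  shows "f (n + N * t) = f n"
proof (induction t)
  case (Suc t)
  have "f (n + N * Suc t) = f ((n + N * t) + N)"
    by (simp add: algebra_simps)
  also have "\<dots> = f n"
    using assms Suc by (simp add: periodic_def)
  finally show ?case .
qed simp

lemma periodic_mod: "periodic N f \<Longrightarrow> f (n mod N) = f n"
  using periodic_add_mult[of N f "n mod N" "n div N"] by simp

lemma periodic_dvd: "periodic N f \<Longrightarrow> N dvd M \<Longrightarrow> periodic M f"
  by (auto simp: periodic_def[of M] periodic_add_mult elim!: dvdE)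

lemma sum_periodic_shift:
  fixes f :: "nat \<Rightarrow> 'a :: comm_ring_1"
  assumes "periodic N f"
  shows "(\<Sum>n<N. f (a + n)) = (\<Sum>n<N. f n)"
proof (induction a)
  case (Suc a)
  have "f a + (\<Sum>n<N. f (Suc a + n)) = (\<Sum>n<Suc N. f (a + n))"
    unfolding sum.lessThan_Suc_shift by simp
  also have "\<dots> = f a + (\<Sum>n<N. f (a + n))"
    using assms by (simp add: periodic_def)
  finally show ?case using Suc by simp
qed simp

section \<open>Residue classes and the Chinese remainder theorem\<close>

lemma sum_lessThan_mult:
  fixes f :: "nat \<Rightarrow> 'a :: comm_monoid_add"
  shows "(\<Sum>n<A * B. f n) = (\<Sum>s<A. \<Sum>t<B. f (s + A * t))"
proof -
  have "(\<Sum>n<A * B. f n) = (\<Sum>t<B. sum f {t * A..<t * A + A})"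
    by (simp add: sum.nat_group mult.commute)
  also have "\<dots> = (\<Sum>t<B. \<Sum>s<A. f (s + A * t))"
  proof (rule sum.cong[OF refl])
    show "sum f {t * A..<t * A + A} = (\<Sum>s<A. f (s + A * t))" for t
      by (rule sum.reindex_bij_witness[of _ "\<lambda>s. s + A * t" "\<lambda>n. n - A * t"])
         (auto simp: ac_simps)
  qed
  finally show ?thesis by (subst sum.swap)
qed

lemma sum_periodic_mult:
  fixes f :: "nat \<Rightarrow> 'a :: comm_ring_1"
  assumes "periodic N f"
  shows "(\<Sum>n<N * t. f n) = of_nat t * (\<Sum>n<N. f n)"
  by (simp add: sum_lessThan_mult periodic_add_mult[OF assms] sum_distrib_left)

text \<open>This is the Chinese remainder theorem. Coprimality gives injectivity, and surjectivity
  follows because both sides have \<open>u * v\<close> elements.\<close>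

lemma bij_betw_residue_pairs:
  fixes u v :: nat
  assumes "coprime u v" "u > 0" "v > 0"
  shows "bij_betw (\<lambda>t. (t mod u, t mod v)) {..<u * v} ({..<u} \<times> {..<v})"
proof -
  have inj: "inj_on (\<lambda>t. (t mod u, t mod v)) {..<u * v}"
  proof (rule inj_onI)
    fix s t assume st: "s \<in> {..<u * v}" "t \<in> {..<u * v}"
      and "(s mod u, s mod v) = (t mod u, t mod v)"
    then have "[s = t] (mod u * v)"
      by (intro coprime_cong_mult_nat assms) (auto simp: cong_def)
    then show "s = t" using st by (simp add: cong_def)
  qed
  have "(\<lambda>t. (t mod u, t mod v)) ` {..<u * v} = {..<u} \<times> {..<v}"
    by (rule card_subset_eq) (use assms in \<open>auto simp: card_image[OF inj]\<close>)
  with inj show ?thesis by (simp add: bij_betw_def)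
qed

text \<open>Residues modulo coprime \<open>u\<close> and \<open>v\<close> are jointly uniform over a
  full period. This is the source of all independence used later.\<close>

lemma sum_periodic_coprime:
  fixes f g :: "nat \<Rightarrow> 'a :: comm_ring_1"
  assumes "periodic u f" "periodic v g" "coprime u v" "u > 0" "v > 0"
  shows "(\<Sum>t<u * v. f t * g t) = (\<Sum>t<u. f t) * (\<Sum>t<v. g t)"
proof -
  have "(\<Sum>t<u. f t) * (\<Sum>t<v. g t) = (\<Sum>(a, b) \<in> {..<u} \<times> {..<v}. f a * g b)"
    by (simp add: sum_product sum.cartesian_product)
  also have "\<dots> = (\<Sum>t<u * v. f (t mod u) * g (t mod v))"
    by (subst sum.reindex_bij_betw[OF bij_betw_residue_pairs[OF assms(3-5)], symmetric]) simp
  finally show ?thesis by (simp add: periodic_mod[OF assms(1)] periodic_mod[OF assms(2)])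
qed

lemma periodic_bounded:
  fixes f :: "nat \<Rightarrow> real"
  assumes "periodic N f" "N > 0"
  obtains C where "\<And>n. \<bar>f n\<bar> \<le> C"
proof
  show "\<bar>f n\<bar> \<le> (\<Sum>m<N. \<bar>f m\<bar>)" for n
    using member_le_sum[of "n mod N" "{..<N}" "\<lambda>m. \<bar>f m\<bar>"] assms
    by (simp add: periodic_mod[OF assms(1)])
qed

text \<open>Subtracting the linear main term from the partial sums leaves a periodic, hence bounded,
  function, so the error in the mean is O(1 / x).\<close>

lemma periodic_mean:
  fixes F :: "nat \<Rightarrow> real"
  assumes "periodic N F" "N > 0"
  shows "((\<lambda>x. 1 / x * (\<Sum>n = 1..nat \<lfloor>x\<rfloor>. F n)) \<longlongrightarrow> (\<Sum>n<N. F n) / real N) at_top"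
proof -
  define A where "A = (\<Sum>n<N. F n) / real N"
  \<comment> \<open>The argument \<open>1 + n\<close> matches the mean, which starts at 1 and not at
    0.\<close>
  define G where "G m = (\<Sum>n<m. F (1 + n)) - real m * A" for m
  have "G (m + N) = G m" for m
  proof -
    have "(\<Sum>n<m + N. F (1 + n)) = (\<Sum>n<m. F (1 + n)) + (\<Sum>n<N. F ((1 + m) + n))"
      by (induction N) (simp_all add: add.assoc add.commute add.left_commute)
    also have "(\<Sum>n<N. F ((1 + m) + n)) = (\<Sum>n<N. F n)"
      by (rule sum_periodic_shift[OF assms(1)])
    also have "\<dots> = real N * A" using assms(2) by (simp add: A_def)
    finally show ?thesis by (simp add: G_def algebra_simps)
  qed
  then have "periodic N G" by (simp add: periodic_def)
  then obtain C where C: "\<And>m. \<bar>G m\<bar> \<le> C"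
    using periodic_bounded assms(2) by blast
  have bound: "\<bar>1 / x * (\<Sum>n = 1..nat \<lfloor>x\<rfloor>. F n) - A\<bar> \<le> (C + \<bar>A\<bar>) / x" if "x > 0" for x
  proof -
    define m where "m = nat \<lfloor>x\<rfloor>"
    have m: "\<bar>real m - x\<bar> \<le> 1" using that unfolding m_def by linarith
    have "(\<Sum>n = 1..m. F n) = (\<Sum>n<m. F (1 + n))"
      by (induction m) simp_all
    then have "(\<Sum>n = 1..m. F n) - x * A = G m + (real m - x) * A"
      by (simp add: G_def algebra_simps)
    also have "\<bar>\<dots>\<bar> \<le> C + 1 * \<bar>A\<bar>"
      using C[of m] mult_right_mono[OF m abs_ge_zero[of A]]
      by (simp add: abs_mult[symmetric])
    finally have "\<bar>(\<Sum>n = 1..m. F n) - x * A\<bar> / x \<le> (C + \<bar>A\<bar>) / x"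
      using that by (simp add: divide_right_mono)
    also have "\<bar>(\<Sum>n = 1..m. F n) - x * A\<bar> / x = \<bar>((\<Sum>n = 1..m. F n) - x * A) / x\<bar>"
      using that by (simp add: abs_divide)
    also have "((\<Sum>n = 1..m. F n) - x * A) / x = 1 / x * (\<Sum>n = 1..m. F n) - A"
      using that by (simp add: field_simps)
    finally show ?thesis by (simp add: m_def)
  qed
  have "((\<lambda>x. 1 / x * (\<Sum>n = 1..nat \<lfloor>x\<rfloor>. F n) - A) \<longlongrightarrow> 0) at_top"
  proof (rule tendsto_0_le)
    show "\<forall>\<^sub>F x in at_top. norm (1 / x * (\<Sum>n = 1..nat \<lfloor>x\<rfloor>. F n) - A) \<le> norm ((C + \<bar>A\<bar>) / x) * 1"
      using eventually_gt_at_top[of 0]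
      by eventually_elim (unfold real_norm_def mult_1_right, rule order_trans[OF bound abs_ge_self])
    show "((\<lambda>x. (C + \<bar>A\<bar>) / x) \<longlongrightarrow> 0) at_top"
      by (intro tendsto_divide_0[OF tendsto_const] filterlim_at_top_imp_at_infinity filterlim_ident)
  qed
  then show ?thesis unfolding A_def by (rule LIM_zero_cancel)
qed

text \<open>Approximation within every positive tolerance by convergent functions forces
  convergence: the limits of the approximants form a Cauchy sequence. The common bound
  \<open>B\<close> survives in the limit.\<close>

lemma approximable_limit:
  fixes w :: "real \<Rightarrow> real"
  assumes "\<And>\<epsilon>. \<epsilon> > 0 \<Longrightarrow> \<exists>v L. (v \<longlongrightarrow> L) at_top \<and> \<bar>L\<bar> \<le> B \<and> (\<forall>\<^sub>F x in at_top. \<bar>w x - v x\<bar> \<le> \<epsilon>)"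
  obtains L where "(w \<longlongrightarrow> L) at_top" "\<bar>L\<bar> \<le> B"
proof -
  have near: "\<exists>L. \<bar>L\<bar> \<le> B \<and> (\<forall>\<^sub>F x in at_top. \<bar>w x - L\<bar> < \<epsilon>)" if \<epsilon>: "\<epsilon> > 0" for \<epsilon>
  proof -
    obtain v L where v: "(v \<longlongrightarrow> L) at_top" "\<bar>L\<bar> \<le> B" "\<forall>\<^sub>F x in at_top. \<bar>w x - v x\<bar> \<le> \<epsilon> / 2"
      using assms[of "\<epsilon> / 2"] \<epsilon> by auto
    have "\<forall>\<^sub>F x in at_top. \<bar>v x - L\<bar> < \<epsilon> / 2"
      using tendstoD[OF v(1), of "\<epsilon> / 2"] \<epsilon> by (simp add: dist_real_def)
    with v(3) have "\<forall>\<^sub>F x in at_top. \<bar>w x - L\<bar> < \<epsilon>"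
      by eventually_elim linarith
    with v(2) show ?thesis by blast
  qed
  then have "\<forall>n. \<exists>L. \<bar>L\<bar> \<le> B \<and> (\<forall>\<^sub>F x in at_top. \<bar>w x - L\<bar> < inverse (real (Suc n)))"
    by simp
  then obtain L where L: "\<And>n. \<bar>L n\<bar> \<le> B"
      "\<And>n. \<forall>\<^sub>F x in at_top. \<bar>w x - L n\<bar> < inverse (real (Suc n))"
    by metis
  \<comment> \<open>Both numbers lie close to \<open>w x\<close> for all large \<open>x\<close>. The
    resulting inequality no longer mentions \<open>x\<close>, so it holds outright.\<close>
  have L_diff: "\<bar>L m - L n\<bar> < inverse (real (Suc m)) + inverse (real (Suc n))" for m n
  proof -
    have "\<forall>\<^sub>F x :: real in at_top. \<bar>L m - L n\<bar> < inverse (real (Suc m)) + inverse (real (Suc n))"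
      using L(2)[of m] L(2)[of n] by eventually_elim linarith
    then show ?thesis by simp
  qed
  have small: "\<exists>M. \<forall>n\<ge>M. inverse (real (Suc n)) < \<epsilon>" if \<epsilon>: "\<epsilon> > 0" for \<epsilon>
  proof -
    obtain M where M: "inverse (real (Suc M)) < \<epsilon>" using reals_Archimedean[OF \<epsilon>] by blast
    have "inverse (real (Suc n)) < \<epsilon>" if "n \<ge> M" for n
      using that by (intro order.strict_trans1[OF _ M] le_imp_inverse_le) auto
    then show ?thesis by blast
  qed
  have "Cauchy L"
  proof (rule metric_CauchyI)
    fix \<epsilon> :: real assume "\<epsilon> > 0"
    then obtain M where M: "\<forall>n\<ge>M. inverse (real (Suc n)) < \<epsilon> / 2" using small[of "\<epsilon> / 2"] by auto
    have "dist (L m) (L n) < \<epsilon>" if "m \<ge> M" "n \<ge> M" for m n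
      using L_diff[of m n] M[rule_format, OF that(1)] M[rule_format, OF that(2)]
      unfolding dist_real_def by linarith
    then show "\<exists>M. \<forall>m\<ge>M. \<forall>n\<ge>M. dist (L m) (L n) < \<epsilon>" by blast
  qed
  then obtain l where l: "L \<longlonglongrightarrow> l" by (auto simp: Cauchy_convergent_iff convergent_def)
  have "\<bar>l\<bar> \<le> B"
    by (rule Lim_bounded[OF tendsto_rabs[OF l], of 0]) (use L(1) in auto)
  moreover have "(w \<longlongrightarrow> l) at_top"
  proof (rule tendstoI)
    fix \<epsilon> :: real assume \<epsilon>: "\<epsilon> > 0"
    then obtain M where M: "\<forall>n\<ge>M. inverse (real (Suc n)) < \<epsilon> / 2" using small[of "\<epsilon> / 2"] by auto
    have "\<forall>\<^sub>F n in sequentially. \<bar>L n - l\<bar> < \<epsilon> / 2"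
      using tendstoD[OF l, of "\<epsilon> / 2"] \<epsilon> by (simp add: dist_real_def)
    then obtain n where n: "n \<ge> M" "\<bar>L n - l\<bar> < \<epsilon> / 2"
      unfolding eventually_sequentially by (meson linear)
    show "\<forall>\<^sub>F x in at_top. dist (w x) l < \<epsilon>"
      using L(2)[of n] by eventually_elim (use n M[rule_format, OF n(1)] in \<open>unfold dist_real_def, linarith\<close>)
  qed
  ultimately show ?thesis using that by blast
qed

section \<open>Sums over short windows\<close>

definition dilate :: "(nat \<Rightarrow> complex) \<Rightarrow> nat \<Rightarrow> nat \<Rightarrow> complex" where
  "dilate f D k = (if D dvd k then f (k div D) else 0)"

definition window :: "(nat \<Rightarrow> complex) \<Rightarrow> nat \<Rightarrow> nat \<Rightarrow> complex" where
  "window f H n = (\<Sum>k = n + 1..n + H. f k)"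

lemma window_conv_lessThan: "window f H n = (\<Sum>h<H. f (n + Suc h))"
  unfolding window_def by (induction H) simp_all

lemma periodic_window:
  assumes "periodic N f"
  shows "periodic N (window f H)"
proof -
  have "f (n + N + Suc h) = f (n + Suc h)" for n h
    using assms unfolding periodic_def by (metis add.commute add.assoc)
  then show ?thesis by (simp add: periodic_def window_conv_lessThan del: add_Suc_right)
qed

lemma periodic_dilate:
  assumes "periodic q f" "D > 0"
  shows "periodic (D * q) (dilate f D)"
  using assms by (simp add: periodic_def dilate_def dvd_add_left_iff)

text \<open>Full periods contribute nothing, so only an incomplete period of length
  \<open>H mod M\<close> remains, whatever the size of \<open>H\<close>.\<close>

lemma norm_window_periodic_le:
  assumes "periodic M f" and zero: "(\<Sum>k<M. f k) = 0" and "M > 0"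
  shows "cmod (window f H n) \<le> (\<Sum>k<M. cmod (f k))"
proof -
  define P where "P m = (\<Sum>h<m. f (Suc n + h))" for m
  have "P (m + M) = P m" for m
  proof -
    have "P (m + M) = P m + (\<Sum>h<M. f ((Suc n + m) + h))"
      unfolding P_def by (induction M) (simp_all add: add.assoc)
    also have "(\<Sum>h<M. f ((Suc n + m) + h)) = 0"
      using zero by (subst sum_periodic_shift[OF assms(1)]) simp
    finally show ?thesis by simp
  qed
  then have "P H = P (H mod M)"
    by (intro periodic_mod[symmetric]) (simp add: periodic_def)
  then have "window f H n = (\<Sum>h<H mod M. f (Suc n + h))"
    by (simp add: window_conv_lessThan P_def)
  also have "cmod \<dots> \<le> (\<Sum>h<H mod M. cmod (f (Suc n + h)))"
    by (rule norm_sum)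
  also have "\<dots> \<le> (\<Sum>h<M. cmod (f (Suc n + h)))"
    using mod_less_divisor[OF \<open>M > 0\<close>, of H] by (intro sum_mono2) auto
  also have "\<dots> = (\<Sum>k<M. cmod (f k))"
    by (rule sum_periodic_shift[where f = "\<lambda>k. cmod (f k)"]) (use assms(1) in \<open>simp add: periodic_def\<close>)
  finally show ?thesis .
qed

text \<open>The bound with \<open>M\<close> uses the pointwise estimate \<open>B\<close> for both
  factors of the square. The bound with \<open>H\<close> keeps \<open>B\<close> for one factor and
  expands the other: each of the \<open>H\<close> shifts contributes at most \<open>B\<close> over a
  period. The latter wins when the windows are short compared with \<open>M\<close>.\<close>

lemma sum_window_sq_le:
  assumes per: "periodic M f" and zero: "(\<Sum>k<M. f k) = 0" and M: "M > 0"
    and B: "(\<Sum>k<M. cmod (f k)) \<le> B"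
  shows "(\<Sum>n<M. (cmod (window f H n))\<^sup>2) \<le> B\<^sup>2 * min (real M) (real H)"
proof -
  have "B \<ge> 0" using B by (meson norm_ge_zero order_trans sum_nonneg)
  have le: "cmod (window f H n) \<le> B" for n
    using norm_window_periodic_le[OF per zero M] B by (rule order_trans)
  have "(\<Sum>n<M. (cmod (window f H n))\<^sup>2) \<le> (\<Sum>n<M. B\<^sup>2)"
    by (intro sum_mono power_mono le norm_ge_zero)
  then have 1: "(\<Sum>n<M. (cmod (window f H n))\<^sup>2) \<le> B\<^sup>2 * real M"
    by (simp add: mult.commute)
  have "(\<Sum>n<M. (cmod (window f H n))\<^sup>2) \<le> (\<Sum>n<M. B * (\<Sum>h<H. cmod (f (n + Suc h))))"
    unfolding power2_eq_square
    by (intro sum_mono mult_mono le \<open>B \<ge> 0\<close> norm_ge_zero)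
       (simp add: window_conv_lessThan norm_sum)
  also have "\<dots> = B * (\<Sum>h<H. \<Sum>n<M. cmod (f (Suc h + n)))"
    unfolding sum_distrib_left[symmetric]
    by (subst sum.swap) (simp add: add.commute)
  also have "\<dots> = B * (\<Sum>h<H. \<Sum>n<M. cmod (f n))"
    by (subst sum_periodic_shift[where f = "\<lambda>k. cmod (f k)"]) (use per in \<open>simp_all add: periodic_def\<close>)
  also have "\<dots> \<le> B * (\<Sum>h<H. B)"
    by (intro mult_left_mono sum_mono B \<open>B \<ge> 0\<close>)
  also have "\<dots> = B\<^sup>2 * real H"
    by (simp add: power2_eq_square)
  finally show ?thesis using 1 by (simp add: min_def)
qed

section \<open>Correlations of dilated characters\<close>

locale nonprincipal_character =
  fixes q :: nat and \<chi> :: "nat \<Rightarrow> complex"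
  assumes character: "dirichlet_character q \<chi>"
    and nonprincipal: "\<not> principal_character q \<chi>"
begin

lemma q_pos: "q > 0"
  and chi_mult: "\<chi> (m * n) = \<chi> m * \<chi> n"
  and periodic_chi: "periodic q \<chi>"
  and chi_eq_0_iff: "\<chi> n = 0 \<longleftrightarrow> \<not> coprime n q"
  using character by (auto simp: dirichlet_character_def periodic_def)

lemma chi_1: "\<chi> 1 = 1"
  using chi_mult[of 1 1] chi_eq_0_iff[of 1] by simp

lemma chi_power: "\<chi> (n ^ k) = \<chi> n ^ k"
  by (induction k) (use chi_1 in \<open>simp_all add: chi_mult\<close>)

text \<open>By Euler's theorem the value is a root of unity.\<close>

lemma norm_chi_coprime:
  assumes "coprime n q"
  shows "cmod (\<chi> n) = 1"
proof -
  have "[n ^ totient q = 1] (mod q)"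
    using assms by (rule euler_theorem)
  then have "\<chi> (n ^ totient q) = \<chi> 1"
    by (metis cong_def periodic_chi periodic_mod)
  then have "cmod (\<chi> n) ^ totient q = 1"
    by (simp add: chi_power chi_1[simplified] norm_power[symmetric])
  then show ?thesis
    using q_pos power_eq_imp_eq_base[of "cmod (\<chi> n)" "totient q" 1] by simp
qed

lemma norm_chi_le_1: "cmod (\<chi> n) \<le> 1"
  using norm_chi_coprime[of n] chi_eq_0_iff[of n] by (cases "coprime n q") auto

text \<open>Multiplication by some \<open>b\<close> with \<open>\<chi> b \<noteq> 1\<close> permutes
  the residues, so the sum equals \<open>\<chi> b\<close> times itself.\<close>

lemma sum_chi: "(\<Sum>n<q. \<chi> n) = 0"
proof -
  obtain b where b: "coprime b q" "\<chi> b \<noteq> 1"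
    using nonprincipal character by (auto simp: principal_character_def)
  have inj: "inj_on (\<lambda>n. (b * n) mod q) {..<q}"
  proof (rule inj_onI)
    fix m n assume mn: "m \<in> {..<q}" "n \<in> {..<q}" "(b * m) mod q = (b * n) mod q"
    then have "[m = n] (mod q)"
      using cong_mult_lcancel_nat[OF b(1), of m n] by (simp add: cong_def)
    then show "m = n" using mn by (simp add: cong_def)
  qed
  have "(\<lambda>n. (b * n) mod q) ` {..<q} = {..<q}"
    by (rule card_subset_eq) (use q_pos in \<open>auto simp: card_image[OF inj]\<close>)
  then have "(\<Sum>n<q. \<chi> n) = (\<Sum>n<q. \<chi> ((b * n) mod q))"
    using sum.reindex[OF inj, of \<chi>] by simp
  also have "\<dots> = \<chi> b * (\<Sum>n<q. \<chi> n)"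
    by (simp add: periodic_mod[OF periodic_chi] chi_mult sum_distrib_left)
  finally show ?thesis using b(2) by simp
qed

text \<open>As \<open>q\<close> is invertible modulo \<open>u\<close>, exactly one \<open>t\<close>
  makes \<open>u\<close> divide \<open>m + q * t\<close>. If the quotient is \<open>e\<close>, then
  \<open>\<chi> u * \<chi> e = \<chi> m\<close>, and \<open>cnj (\<chi> u)\<close> is the inverse of
  \<open>\<chi> u\<close>.\<close>

lemma sum_dilate_sections:
  assumes "u > 0" "coprime u q"
  shows "(\<Sum>t<u. dilate \<chi> u (m + q * t)) = cnj (\<chi> u) * \<chi> m"
proof -
  obtain x where x: "[q * x = 1] (mod u)"
    using cong_solve_coprime_nat[of q u] assms(2) by (auto simp: coprime_commute)
  \<comment> \<open>The solution of \<open>m + q * t = 0\<close> modulo \<open>u\<close>; in the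
    natural numbers \<open>(u - 1) * m\<close> stands for the residue of \<open>-m\<close>.\<close>
  define t0 where "t0 = (x * ((u - 1) * m)) mod u"
  have "[m + q * t0 = m + q * (x * ((u - 1) * m))] (mod u)"
    unfolding t0_def by (intro cong_add cong_mult cong_refl) (simp add: cong_def)
  also have "[m + q * (x * ((u - 1) * m)) = m + 1 * ((u - 1) * m)] (mod u)"
    unfolding mult.assoc[symmetric, of q x] by (intro cong_add cong_mult cong_refl x)
  also have "m + 1 * ((u - 1) * m) = u * m"
    using assms(1) by (cases u) auto
  also have "[u * m = 0] (mod u)" by (simp add: cong_def)
  finally have t0: "u dvd m + q * t0" by (simp add: cong_0_iff)
  have "t0 < u" unfolding t0_def using assms(1) by simp
  have uniq: "t = t0" if "t < u" "u dvd m + q * t" for t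
  proof -
    have "[m + q * t = m + q * t0] (mod u)"
      using t0 that(2) by (simp add: cong_def dvd_eq_mod_eq_0)
    then have "[t = t0] (mod u)"
      using assms(2) by (simp add: cong_add_lcancel_nat cong_mult_lcancel_nat coprime_commute)
    then show ?thesis using \<open>t0 < u\<close> that(1) by (simp add: cong_def)
  qed
  obtain e where e: "m + q * t0 = u * e" using t0 by blast
  have "(\<Sum>t<u. dilate \<chi> u (m + q * t)) = (\<Sum>t<u. if t = t0 then \<chi> e else 0)"
  proof (rule sum.cong[OF refl])
    fix t assume "t \<in> {..<u}"
    then show "dilate \<chi> u (m + q * t) = (if t = t0 then \<chi> e else 0)"
    proof (cases "t = t0")
      case False
      with uniq \<open>t \<in> {..<u}\<close> have "\<not> u dvd m + q * t" by auto
      with False show ?thesis by (simp add: dilate_def)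
    qed (use e assms(1) in \<open>simp add: dilate_def\<close>)
  qed
  also have "\<dots> = \<chi> e" using \<open>t0 < u\<close> by simp
  also have "\<dots> = cnj (\<chi> u) * (\<chi> u * \<chi> e)"
    using norm_chi_coprime[OF assms(2)]
    by (simp add: mult.assoc[symmetric] mult.commute[of "cnj _"] complex_norm_square[symmetric])
  also have "\<chi> u * \<chi> e = \<chi> m"
    by (simp add: chi_mult[symmetric] e[symmetric] periodic_add_mult[OF periodic_chi])
  finally show ?thesis .
qed

text \<open>If \<open>G\<close> does not divide \<open>k\<close>, it divides no term of the
  progression and both sides vanish; otherwise \<open>G\<close> is divided out.\<close>

lemma sum_dilate_mult_sections:
  assumes "G > 0" "u > 0" "coprime u q"
  shows "(\<Sum>t<u. dilate \<chi> (G * u) (k + G * q * t)) = cnj (\<chi> u) * dilate \<chi> G k"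
proof (cases "G dvd k")
  case False
  then have "\<not> G * u dvd k + G * q * t" for t
    by (metis dvd_add_left_iff dvd_mult_left dvd_triv_left mult.assoc)
  with False show ?thesis by (simp add: dilate_def)
next
  case True
  then obtain m where k: "k = G * m" by blast
  have "dilate \<chi> (G * u) (k + G * q * t) = dilate \<chi> u (m + q * t)" for t
  proof -
    have "k + G * q * t = G * (m + q * t)" by (simp add: k algebra_simps)
    then show ?thesis using assms(1) by (simp add: dilate_def)
  qed
  then show ?thesis
    using sum_dilate_sections[OF assms(2,3), of m] assms(1) by (simp add: dilate_def k)
qed

lemma sum_window_dilate_sections:
  assumes "G > 0" "u > 0" "coprime u q"
  shows "(\<Sum>t<u. window (dilate \<chi> (G * u)) H (s + G * q * t)) = cnj (\<chi> u) * window (dilate \<chi> G) H s"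
proof -
  have "(\<Sum>t<u. window (dilate \<chi> (G * u)) H (s + G * q * t)) =
      (\<Sum>h<H. \<Sum>t<u. dilate \<chi> (G * u) ((s + Suc h) + G * q * t))"
    unfolding window_conv_lessThan by (subst sum.swap) (simp add: ac_simps)
  then show ?thesis
    by (simp only: sum_dilate_mult_sections[OF assms] window_conv_lessThan sum_distrib_left)
qed

text \<open>Along each progression \<open>s + G q t\<close> the two windows depend on \<open>t\<close> modulo the coprime
  numbers \<open>u\<close> and \<open>v\<close>, so they are independent and only their averages matter.\<close>

lemma window_correlation:
  assumes "G > 0" "u > 0" "v > 0" "coprime u v" "coprime u q" "coprime v q"
  shows "(\<Sum>n<G * q * (u * v). window (dilate \<chi> (G * u)) H n * cnj (window (dilate \<chi> (G * v)) H n)) =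
    cnj (\<chi> u) * \<chi> v * (\<Sum>n<G * q. of_real ((cmod (window (dilate \<chi> G) H n))\<^sup>2))"
proof -
  \<comment> \<open>Advancing \<open>t\<close> by \<open>w\<close> moves the argument by
    \<open>G * w * q\<close>, a full period of the dilate.\<close>
  have per: "periodic w (\<lambda>t. window (dilate \<chi> (G * w)) H (s + G * q * t))" if "w > 0" for w s
  proof -
    have "window (dilate \<chi> (G * w)) H ((s + G * q * t) + G * w * q) =
        window (dilate \<chi> (G * w)) H (s + G * q * t)" for t
      using periodic_window[OF periodic_dilate[OF periodic_chi, of "G * w"], of H] assms(1) that
      by (simp add: periodic_def)
    moreover have "s + G * q * (t + w) = (s + G * q * t) + G * w * q" for t
      by (simp add: algebra_simps)
    ultimately show ?thesis by (simp only: periodic_def simp_thms)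
  qed
  have "(\<Sum>n<G * q * (u * v). window (dilate \<chi> (G * u)) H n * cnj (window (dilate \<chi> (G * v)) H n)) =
    (\<Sum>s<G * q. \<Sum>t<u * v. window (dilate \<chi> (G * u)) H (s + G * q * t) *
                            cnj (window (dilate \<chi> (G * v)) H (s + G * q * t)))"
    by (rule sum_lessThan_mult)
  also have "\<dots> = (\<Sum>s<G * q. (\<Sum>t<u. window (dilate \<chi> (G * u)) H (s + G * q * t)) *
                            (\<Sum>t<v. cnj (window (dilate \<chi> (G * v)) H (s + G * q * t))))"
    by (intro sum.cong refl sum_periodic_coprime assms per)
       (use per[OF assms(3)] in \<open>simp add: periodic_def\<close>)
  also have "\<dots> = (\<Sum>s<G * q. cnj (\<chi> u) * \<chi> v * of_real ((cmod (window (dilate \<chi> G) H s))\<^sup>2))"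
    unfolding cnj_sum[symmetric] sum_window_dilate_sections[OF assms(1,2,5)]
      sum_window_dilate_sections[OF assms(1,3,6)] complex_norm_square
    by (simp add: mult_ac)
  finally show ?thesis by (simp add: sum_distrib_left)
qed

text \<open>Writing \<open>k = s + G * t\<close>, only \<open>s = 0\<close> contributes, which
  leaves one period of \<open>\<chi>\<close>. The second bound is therefore independent of
  \<open>G\<close>.\<close>

lemma sum_dilate:
  assumes "G > 0"
  shows "(\<Sum>k<G * q. dilate \<chi> G k) = 0" "(\<Sum>k<G * q. cmod (dilate \<chi> G k)) \<le> real q"
proof -
  have *: "dilate \<chi> G (s + G * t) = (if s = 0 then \<chi> t else 0)" if "s < G" for s t
    using that by (auto simp: dilate_def nat_dvd_not_less dvd_add_left_iff)
  have "(\<Sum>k<G * q. dilate \<chi> G k) = (\<Sum>s<G. if s = 0 then \<Sum>t<q. \<chi> t else 0)"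
    unfolding sum_lessThan_mult by (intro sum.cong) (auto simp: *)
  then show "(\<Sum>k<G * q. dilate \<chi> G k) = 0" by (simp add: sum_chi)
  have "(\<Sum>k<G * q. cmod (dilate \<chi> G k)) = (\<Sum>s<G. if s = 0 then \<Sum>t<q. cmod (\<chi> t) else 0)"
    unfolding sum_lessThan_mult by (intro sum.cong) (auto simp: *)
  also have "\<dots> \<le> real q"
    using assms sum_mono[of "{..<q}" "\<lambda>t. cmod (\<chi> t)" "\<lambda>_. 1"] by (simp add: norm_chi_le_1)
  finally show "(\<Sum>k<G * q. cmod (dilate \<chi> G k)) \<le> real q" .
qed

text \<open>\<open>N\<close> may be any multiple of the joint period, so that all pairs of dilates
  can be summed over one range. The bound comes from \<open>sum_window_sq_le\<close> with period
  \<open>G * q\<close> and \<open>B = q\<close>.\<close>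

lemma window_correlation_le:
  assumes "G > 0" "u > 0" "v > 0" "coprime u v" "coprime u q" "coprime v q"
    and N: "G * q * (u * v) dvd N"
  shows "cmod (\<Sum>n<N. window (dilate \<chi> (G * u)) H n * cnj (window (dilate \<chi> (G * v)) H n))
    \<le> real N * (real q)\<^sup>2 * (min 1 (real H / real G) / (real u * real v))"
    (is "cmod (sum ?c _) \<le> _")
proof -
  obtain t where t: "N = G * q * (u * v) * t" using N by blast
  have per: "periodic (G * q * (u * v)) (window (dilate \<chi> (G * w)) H)" if "w > 0" "w dvd u * v" for w
    by (rule periodic_window, rule periodic_dvd[OF periodic_dilate[OF periodic_chi, of "G * w"]])
       (use that assms(1) in \<open>auto simp: mult_ac\<close>)
  have "periodic (G * q * (u * v)) ?c"
    using per[of u] per[of v] assms by (simp add: periodic_def)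
  then have "sum ?c {..<N} = of_nat t * (\<Sum>n<G * q * (u * v). ?c n)"
    unfolding t by (rule sum_periodic_mult)
  also have "cmod \<dots> = real t * (\<Sum>n<G * q. (cmod (window (dilate \<chi> G) H n))\<^sup>2)"
    unfolding window_correlation[OF assms(1-6)] of_real_sum[symmetric] norm_mult norm_of_real
    by (simp add: norm_chi_coprime assms sum_nonneg)
  also have "\<dots> \<le> real t * ((real q)\<^sup>2 * min (real (G * q)) (real H))"
    using assms(1) q_pos
    by (intro mult_left_mono sum_window_sq_le sum_dilate periodic_dilate periodic_chi) auto
  also have "\<dots> \<le> real t * ((real q)\<^sup>2 * (real (G * q) * min 1 (real H / real G)))"
  proof -
    \<comment> \<open>Enlarging \<open>H\<close> to \<open>q * H\<close> allows the length
      \<open>G * q\<close> to be taken out of the minimum.\<close>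
    have "real H \<le> real q * real H"
      using q_pos mult_right_mono[of 1 "real q" "real H"] by simp
    moreover have "real (G * q) * min 1 (real H / real G) = min (real (G * q)) (real q * real H)"
      using assms(1) by (subst min_mult_distrib_left) simp
    ultimately have "min (real (G * q)) (real H) \<le> real (G * q) * min 1 (real H / real G)"
      by linarith
    then show ?thesis by (intro mult_left_mono) auto
  qed
  also have "\<dots> = real N * (real q)\<^sup>2 * (min 1 (real H / real G) / (real u * real v))"
    using assms(1-3) by (simp add: t)
  finally show ?thesis .
qed

end

section \<open>The mean square of a combination of dilates\<close>

text \<open>Comparison with a telescoping sum: \<open>1 / (M + 1)^2\<close> is at most
  \<open>1 / M - 1 / (M + 1)\<close>.\<close>

lemma sum_inverse_power_tail_le:
  fixes T M j :: nat
  assumes "j \<ge> 2" "T \<ge> 1"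
  shows "(\<Sum>a = Suc T..M. 1 / real a ^ j) \<le> 1 / real T"
proof (cases "T \<le> M")
  case True
  then have "(\<Sum>a = Suc T..M. 1 / real a ^ j) \<le> 1 / real T - 1 / real M"
  proof (induction M rule: dec_induct)
    case (step M)
    have M: "real M \<ge> 1" using step assms by simp
    have "1 / real (Suc M) ^ j \<le> 1 / real (Suc M) ^ 2"
      using assms by (intro divide_left_mono power_increasing) auto
    also have "\<dots> \<le> 1 / (real M * real (Suc M))"
      using M unfolding power2_eq_square by (intro divide_left_mono mult_right_mono mult_pos_pos) auto
    also have "\<dots> = 1 / real M - 1 / real (Suc M)"
      using M by (simp add: field_simps)
    finally show ?case using step by simp
  qed simp
  then show ?thesis by (smt (verit) divide_nonneg_nonneg of_nat_0_le_iff)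
qed simp

lemma sum_inverse_power_le:
  assumes "j \<ge> 2"
  shows "(\<Sum>a = 1..M. 1 / real a ^ j) \<le> 2"
proof (cases "M = 0")
  case False
  then have "{1..M} = insert 1 {Suc 1..M}" by auto
  then show ?thesis
    using sum_inverse_power_tail_le[OF assms, of 1 M] by simp
qed simp

text \<open>Here \<open>y\<close> stands for \<open>H\<close> to the power \<open>1 / j\<close>.
  Terms up to about \<open>y\<close> are bounded by 1, and later ones by \<open>y^2 / g^2\<close>,
  since \<open>y / g \<le> 1\<close> and \<open>j \<ge> 2\<close>. The total is at most
  \<open>(y + 1) + y\<close>.\<close>

lemma sum_min_power_le:
  fixes y :: real
  assumes "j \<ge> 2" "y \<ge> 1"
  shows "(\<Sum>g = 1..M. min 1 (y ^ j / real g ^ j)) \<le> 3 * y"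
proof -
  define T where "T = nat \<lceil>y\<rceil>"
  have T: "T \<ge> 1" "y \<le> real T" "real T \<le> y + 1"
    using assms(2) unfolding T_def by linarith+
  have le: "min 1 (y ^ j / real g ^ j) \<le> y\<^sup>2 * (1 / real g ^ 2)" if "g \<ge> Suc T" for g
  proof -
    have g: "y / real g \<le> 1" "0 \<le> y / real g" using that T assms(2) by auto
    have "(y / real g) ^ j \<le> (y / real g) ^ 2"
      by (rule power_decreasing[OF assms(1) g(2,1)])
    then show ?thesis by (simp add: power_divide min.coboundedI2)
  qed
  \<comment> \<open>\<open>T\<close> may exceed \<open>M\<close>; the union then contains extra
    nonnegative terms.\<close>
  have "(\<Sum>g = 1..M. min 1 (y ^ j / real g ^ j)) \<le>
      (\<Sum>g\<in>{1..T} \<union> {Suc T..M}. min 1 (y ^ j / real g ^ j))"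
    using assms(2) by (intro sum_mono2) auto
  also have "\<dots> = (\<Sum>g = 1..T. min 1 (y ^ j / real g ^ j)) + (\<Sum>g = Suc T..M. min 1 (y ^ j / real g ^ j))"
    by (rule sum.union_disjoint) auto
  also have "\<dots> \<le> (\<Sum>g = 1..T. 1) + (\<Sum>g = Suc T..M. y\<^sup>2 * (1 / real g ^ 2))"
    by (intro add_mono sum_mono le) auto
  also have "\<dots> \<le> real T + y\<^sup>2 * (1 / real T)"
    unfolding sum_distrib_left[symmetric]
    by (intro add_mono mult_left_mono sum_inverse_power_tail_le T) auto
  also have "y\<^sup>2 * (1 / real T) \<le> y"
    using T assms(2) by (simp add: field_simps power2_eq_square)
  finally show ?thesis using T assms(2) by linarith
qed

text \<open>A pair is determined by its gcd and its two cofactors. Dropping the coprimality of the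
  cofactors makes the triple sum factor.\<close>

lemma sum_gcd_le:
  fixes m w :: "nat \<Rightarrow> real"
  assumes "finite \<D>" "\<And>d. d \<in> \<D> \<Longrightarrow> d > 0" "\<And>d. d \<in> \<D> \<Longrightarrow> d \<le> M"
    and nonneg: "\<And>n. m n \<ge> 0" "\<And>n. w n \<ge> 0"
  shows "(\<Sum>d\<in>\<D>. \<Sum>e\<in>\<D>. m (gcd d e) * (w (d div gcd d e) * w (e div gcd d e)))
    \<le> (\<Sum>g = 1..M. m g) * (\<Sum>a = 1..M. w a)\<^sup>2"
proof -
  define \<phi> where "\<phi> = (\<lambda>(d :: nat, e :: nat). (gcd d e, d div gcd d e, e div gcd d e))"
  let ?F = "\<lambda>(g, a, b). m g * (w a * w b)"
  have inj: "inj_on \<phi> (\<D> \<times> \<D>)"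
  proof (rule inj_on_inverseI)
    show "(\<lambda>(g, a, b). (g * a, g * b)) (\<phi> x) = x" if "x \<in> \<D> \<times> \<D>" for x
      by (cases x) (simp add: \<phi>_def)
  qed
  have "\<phi> ` (\<D> \<times> \<D>) \<subseteq> {1..M} \<times> {1..M} \<times> {1..M}"
  proof (rule image_subsetI)
    fix x assume "x \<in> \<D> \<times> \<D>"
    then obtain d e where x: "x = (d, e)" and de: "d > 0" "e > 0" "d \<le> M" "e \<le> M"
      using assms by blast
    have "gcd d e \<le> d" "gcd d e \<le> e" using de by (auto intro: gcd_le1_nat gcd_le2_nat)
    moreover have "d div gcd d e \<le> d" "e div gcd d e \<le> e" by (rule div_le_dividend)+
    ultimately have "gcd d e \<le> M" "d div gcd d e \<le> M" "e div gcd d e \<le> M"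
      using de by linarith+
    then show "\<phi> x \<in> {1..M} \<times> {1..M} \<times> {1..M}"
      using de by (simp add: x \<phi>_def Suc_le_eq div_greater_zero_iff)
  qed
  then have "sum ?F (\<phi> ` (\<D> \<times> \<D>)) \<le> sum ?F ({1..M} \<times> {1..M} \<times> {1..M})"
    using nonneg by (intro sum_mono2) (auto intro!: mult_nonneg_nonneg)
  also have "sum ?F (\<phi> ` (\<D> \<times> \<D>)) = (\<Sum>d\<in>\<D>. \<Sum>e\<in>\<D>. m (gcd d e) * (w (d div gcd d e) * w (e div gcd d e)))"
    unfolding sum.reindex[OF inj] by (simp add: sum.cartesian_product \<phi>_def case_prod_unfold)
  also have "sum ?F ({1..M} \<times> {1..M} \<times> {1..M}) = (\<Sum>g = 1..M. m g * (\<Sum>a = 1..M. \<Sum>b = 1..M. w a * w b))"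
    by (simp add: sum.cartesian_product[symmetric] sum_distrib_left)
  also have "\<dots> = (\<Sum>g = 1..M. m g) * (\<Sum>a = 1..M. w a)\<^sup>2"
    unfolding power2_eq_square sum_product[of w] by (rule sum_distrib_right[symmetric])
  finally show ?thesis .
qed

text \<open>The triangle inequality is applied only after the sum over \<open>A\<close> has been
  moved inside, so cancellation within each correlation is kept.\<close>

lemma sum_norm_sq_combination_le:
  fixes c :: "'b \<Rightarrow> complex" and W :: "'b \<Rightarrow> 'a \<Rightarrow> complex"
  assumes "\<And>d. d \<in> \<D> \<Longrightarrow> cmod (c d) \<le> 1"
  shows "(\<Sum>n\<in>A. (cmod (\<Sum>d\<in>\<D>. c d * W d n))\<^sup>2) \<le>
    (\<Sum>d\<in>\<D>. \<Sum>e\<in>\<D>. cmod (\<Sum>n\<in>A. W d n * cnj (W e n)))"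
proof -
  have "complex_of_real (\<Sum>n\<in>A. (cmod (\<Sum>d\<in>\<D>. c d * W d n))\<^sup>2) =
      (\<Sum>n\<in>A. \<Sum>d\<in>\<D>. \<Sum>e\<in>\<D>. (c d * cnj (c e)) * (W d n * cnj (W e n)))"
    unfolding of_real_sum complex_norm_square cnj_sum sum_product
    by (simp add: mult_ac)
  also have "\<dots> = (\<Sum>d\<in>\<D>. \<Sum>e\<in>\<D>. (c d * cnj (c e)) * (\<Sum>n\<in>A. W d n * cnj (W e n)))"
    by (subst sum.swap, intro sum.cong refl, subst sum.swap) (simp add: sum_distrib_left)
  finally have "cmod (complex_of_real (\<Sum>n\<in>A. (cmod (\<Sum>d\<in>\<D>. c d * W d n))\<^sup>2)) =
      cmod (\<Sum>d\<in>\<D>. \<Sum>e\<in>\<D>. (c d * cnj (c e)) * (\<Sum>n\<in>A. W d n * cnj (W e n)))"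
    by (rule arg_cong)
  also have "\<dots> \<le> (\<Sum>d\<in>\<D>. \<Sum>e\<in>\<D>. cmod (c d * cnj (c e)) * cmod (\<Sum>n\<in>A. W d n * cnj (W e n)))"
    unfolding norm_mult[symmetric] by (intro order_trans[OF norm_sum] sum_mono norm_sum)
  also have "\<dots> \<le> (\<Sum>d\<in>\<D>. \<Sum>e\<in>\<D>. 1 * cmod (\<Sum>n\<in>A. W d n * cnj (W e n)))"
    using assms by (intro sum_mono mult_right_mono) (auto simp: norm_mult intro!: mult_le_one)
  finally show ?thesis by (simp add: sum_nonneg del: of_real_sum)
qed

section \<open>Summing the correlations over all pairs of dilates\<close>

context nonprincipal_character
begin

text \<open>With \<open>d = g * a\<close> and \<open>e = g * b\<close>, this is
  \<open>window_correlation_le\<close> for the common factor \<open>r * g ^ j\<close> and the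
  coprime cofactors \<open>a ^ j\<close> and \<open>b ^ j\<close>. Then \<open>r \<ge> 1\<close> is
  dropped from the denominator.\<close>

lemma window_power_correlation_le:
  assumes "r > 0" "d > 0" "e > 0" "coprime d q" "coprime e q"
    and N: "r * q * (d ^ j * e ^ j) dvd N"
  shows "cmod (\<Sum>n<N. window (dilate \<chi> (r * d ^ j)) H n * cnj (window (dilate \<chi> (r * e ^ j)) H n))
    \<le> real N * (real q)\<^sup>2 * (min 1 (real H / real (gcd d e) ^ j) *
        (1 / real (d div gcd d e) ^ j * (1 / real (e div gcd d e) ^ j)))"
proof -
  define g a b where "g = gcd d e" and "a = d div g" and "b = e div g"
  have d: "d = g * a" and e: "e = g * b" by (simp_all add: g_def a_def b_def)
  have pos: "g > 0" "a > 0" "b > 0" using assms(2,3) by (simp_all add: d e)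
  have ab: "coprime a b" unfolding a_def b_def g_def using assms(2) by (intro div_gcd_coprime) auto
  have cop: "coprime a q" "coprime b q" using assms(4,5) by (simp_all add: d e)
  have eqs: "r * d ^ j = r * g ^ j * a ^ j" "r * e ^ j = r * g ^ j * b ^ j"
    by (simp_all add: d e power_mult_distrib)
  have "(r * g ^ j) * q * (a ^ j * b ^ j) dvd r * q * (d ^ j * e ^ j)"
    by (simp add: d e power_mult_distrib mult_ac)
  then have dvd: "(r * g ^ j) * q * (a ^ j * b ^ j) dvd N" using N by (rule dvd_trans)
  have "cmod (\<Sum>n<N. window (dilate \<chi> (r * d ^ j)) H n * cnj (window (dilate \<chi> (r * e ^ j)) H n))
    \<le> real N * (real q)\<^sup>2 * (min 1 (real H / real (r * g ^ j)) / (real (a ^ j) * real (b ^ j)))"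
    unfolding eqs using assms(1) pos ab cop
    by (intro window_correlation_le dvd) auto
  also have "\<dots> \<le> real N * (real q)\<^sup>2 * (min 1 (real H / real g ^ j) / (real (a ^ j) * real (b ^ j)))"
  proof -
    have "real H / real (r * g ^ j) \<le> real H / real g ^ j"
      using assms(1) pos by (intro divide_left_mono) auto
    then show ?thesis by (intro mult_left_mono divide_right_mono) auto
  qed
  finally show ?thesis by (simp add: g_def a_def b_def)
qed

text \<open>Grouping by gcd leaves one sum of size O(\<open>y\<close>) and two sums at most 2. After
  division by \<open>N\<close> the bound is free of \<open>r\<close> and \<open>\<D>\<close>, hence
  uniform in the sieve.\<close>

lemma mean_square_combination_le:
  fixes c :: "nat \<Rightarrow> complex" and y :: real
  assumes "j \<ge> 2" "r > 0" "finite \<D>" "\<And>d. d \<in> \<D> \<Longrightarrow> d > 0 \<and> coprime d q \<and> cmod (c d) \<le> 1"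
    and N: "\<And>d e. d \<in> \<D> \<Longrightarrow> e \<in> \<D> \<Longrightarrow> r * q * (d ^ j * e ^ j) dvd N"
    and y: "y \<ge> 1" "y ^ j = real H"
  shows "(\<Sum>n<N. (cmod (\<Sum>d\<in>\<D>. c d * window (dilate \<chi> (r * d ^ j)) H n))\<^sup>2) \<le> real N * (real q)\<^sup>2 * (12 * y)"
proof -
  let ?m = "\<lambda>g. min 1 (y ^ j / real g ^ j)" and ?w = "\<lambda>a. 1 / real a ^ j"
  have "y > 0" using y by simp
  have "(\<Sum>n<N. (cmod (\<Sum>d\<in>\<D>. c d * window (dilate \<chi> (r * d ^ j)) H n))\<^sup>2) \<le>
      (\<Sum>d\<in>\<D>. \<Sum>e\<in>\<D>. cmod (\<Sum>n<N. window (dilate \<chi> (r * d ^ j)) H n * cnj (window (dilate \<chi> (r * e ^ j)) H n)))"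
    using assms(4) by (intro sum_norm_sq_combination_le) auto
  also have "\<dots> \<le> (\<Sum>d\<in>\<D>. \<Sum>e\<in>\<D>. real N * (real q)\<^sup>2 * (?m (gcd d e) * (?w (d div gcd d e) * ?w (e div gcd d e))))"
    unfolding y(2) using assms(2,4) by (intro sum_mono window_power_correlation_le N) auto
  also have "\<dots> = real N * (real q)\<^sup>2 * (\<Sum>d\<in>\<D>. \<Sum>e\<in>\<D>. ?m (gcd d e) * (?w (d div gcd d e) * ?w (e div gcd d e)))"
    unfolding sum_distrib_left ..
  also have "\<dots> \<le> real N * (real q)\<^sup>2 * ((\<Sum>g = 1..Max \<D>. ?m g) * (\<Sum>a = 1..Max \<D>. ?w a)\<^sup>2)"
    using assms(3,4) \<open>y > 0\<close> by (intro mult_left_mono sum_gcd_le) auto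
  also have "\<dots> \<le> real N * (real q)\<^sup>2 * ((3 * y) * 2\<^sup>2)"
    using \<open>y > 0\<close>
    by (intro mult_left_mono mult_mono power_mono sum_min_power_le sum_inverse_power_le assms(1) y(1) sum_nonneg) auto
  finally show ?thesis by simp
qed

end

section \<open>Power-free integers and their periodic approximation\<close>

lemma not_coprime_common_prime:
  fixes a b :: nat
  assumes "\<not> coprime a b"
  obtains p where "prime p" "p dvd a" "p dvd b"
proof -
  have "gcd a b \<noteq> 1" using assms unfolding coprime_iff_gcd_eq_1 .
  from prime_factor_nat[OF this] show ?thesis using that by auto
qed

lemma coprime_if_prime_divisors:
  fixes r m q :: nat
  assumes "\<And>p. prime p \<Longrightarrow> p dvd r \<Longrightarrow> p dvd q" "coprime m q"
  shows "coprime r m"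
proof (rule ccontr)
  assume "\<not> coprime r m"
  then obtain p where p: "prime p" "p dvd r" "p dvd m" by (rule not_coprime_common_prime)
  then have "p dvd q" "p dvd m" using assms(1) by auto
  then show False using assms(2) p(1) by (meson coprime_common_divisor not_prime_unit)
qed

text \<open>Primes shared with \<open>q\<close> are moved into \<open>r\<close> one at a time, and
  \<open>k\<close> shrinks until none is left.\<close>

lemma smooth_coprime_decomposition:
  fixes k q :: nat
  assumes "k > 0"
  shows "\<exists>r m. k = r * m \<and> coprime m q \<and> (\<forall>p. prime p \<longrightarrow> p dvd r \<longrightarrow> p dvd q)"
  using assms
proof (induction k rule: less_induct)
  case (less k)
  show ?case
  proof (cases "coprime k q")
    case True
    then have "k = 1 * k \<and> coprime k q \<and> (\<forall>p. prime p \<longrightarrow> p dvd 1 \<longrightarrow> p dvd q)" by auto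
    then show ?thesis by blast
  next
    case False
    then obtain p where p: "prime p" "p dvd k" "p dvd q" by (rule not_coprime_common_prime)
    then obtain k' where k': "k = p * k'" by auto
    have "k' < k" "k' > 0" using k' less.prems prime_gt_1_nat[OF p(1)] by auto
    with less.IH obtain r m where rm: "k' = r * m" "coprime m q"
      "\<forall>p. prime p \<longrightarrow> p dvd r \<longrightarrow> p dvd q" by blast
    have "k = (p * r) * m" by (simp add: k' rm)
    moreover have "s dvd q" if "prime s" "s dvd p * r" for s
      using that rm(3) p by (auto simp: prime_dvd_mult_iff primes_dvd_imp_eq)
    ultimately show ?thesis using rm(2) by blast
  qed
qed

text \<open>One notion for both cases: \<open>j = 2\<close> gives squarefree and
  \<open>j = 3\<close> cubefree integers. The number 0 is excluded, as every power divides
  it.\<close>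

definition powerfree :: "nat \<Rightarrow> nat \<Rightarrow> bool" where
  "powerfree j n \<longleftrightarrow> (\<forall>p. prime p \<longrightarrow> \<not> p ^ j dvd n)"

text \<open>Each prime of \<open>r\<close> has exponent at most \<open>j - 1\<close> in
  \<open>r\<close> and at least 1 in \<open>q\<close>. Hence only finitely many such
  \<open>r\<close> exist.\<close>

lemma powerfree_smooth_dvd:
  assumes "j \<ge> 1" "r > 0" "powerfree j r" "\<And>p. prime p \<Longrightarrow> p dvd r \<Longrightarrow> p dvd q" "q > 0"
  shows "r dvd q ^ (j - 1)"
proof (rule multiplicity_le_imp_dvd)
  fix p :: nat assume p: "prime p"
  show "multiplicity p r \<le> multiplicity p (q ^ (j - 1))"
  proof (cases "p dvd r")
    case True
    have "\<not> j \<le> multiplicity p r"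
      using assms(2,3) p multiplicity_dvd'[of j p r] by (auto simp: powerfree_def)
    moreover have "multiplicity p q \<ge> 1"
      using assms(4)[OF p True] assms(5) prime_gt_1_nat[OF p] multiplicity_gt_zero_iff[of q p]
      by (simp add: Suc_le_eq)
    then have "(j - 1) * 1 \<le> (j - 1) * multiplicity p q" by (rule mult_le_mono2)
    ultimately have "multiplicity p r \<le> (j - 1) * multiplicity p q" by linarith
    then show ?thesis
      using p assms(5) by (simp add: prime_elem_multiplicity_power_distrib)
  qed (simp add: not_dvd_imp_multiplicity_0)
qed (use assms in auto)

section \<open>Density of the exceptional integers and its effect on the mean\<close>

lemma card_multiples_le: "card {k \<in> {1..m}. a dvd k} \<le> m div a"
proof (cases "a = 0")
  case False
  have "{k \<in> {1..m}. a dvd k} \<subseteq> (\<lambda>i. a * i) ` {1..m div a}"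
    using False by (auto elim!: dvdE simp: less_eq_div_iff_mult_less_eq mult.commute Suc_le_eq)
  then have "card {k \<in> {1..m}. a dvd k} \<le> card ((\<lambda>i. a * i) ` {1..m div a})"
    by (intro card_mono) auto
  also have "\<dots> \<le> m div a" using card_image_le[of "{1..m div a}"] by simp
  finally show ?thesis .
qed (auto simp: card_eq_0_iff)

lemma card_large_power_divisors_le:
  assumes "j \<ge> 2" "Z \<ge> 1"
  shows "real (card {k \<in> {1..m}. \<exists>p>Z. p ^ j dvd k}) \<le> real m / real Z"
proof -
  \<comment> \<open>Since \<open>p \<le> p ^ j \<le> k \<le> m\<close>, finitely many
    \<open>p\<close> suffice.\<close>
  have "{k \<in> {1..m}. \<exists>p>Z. p ^ j dvd k} \<subseteq> (\<Union>p\<in>{Suc Z..m}. {k \<in> {1..m}. p ^ j dvd k})"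
  proof
    fix k assume "k \<in> {k \<in> {1..m}. \<exists>p>Z. p ^ j dvd k}"
    then obtain p where p: "p > Z" "p ^ j dvd k" "k \<in> {1..m}" by blast
    then have "p ^ j \<le> m" using dvd_imp_le[of "p ^ j" k] by auto
    moreover have "p \<le> p ^ j" using p(1) assms by (intro self_le_power) auto
    ultimately show "k \<in> (\<Union>p\<in>{Suc Z..m}. {k \<in> {1..m}. p ^ j dvd k})" using p by auto
  qed
  then have "card {k \<in> {1..m}. \<exists>p>Z. p ^ j dvd k} \<le> card (\<Union>p\<in>{Suc Z..m}. {k \<in> {1..m}. p ^ j dvd k})"
    by (intro card_mono) auto
  also have "\<dots> \<le> (\<Sum>p\<in>{Suc Z..m}. m div p ^ j)"
    by (intro order_trans[OF card_UN_le] sum_mono card_multiples_le) auto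
  finally have "real (card {k \<in> {1..m}. \<exists>p>Z. p ^ j dvd k}) \<le> (\<Sum>p\<in>{Suc Z..m}. real (m div p ^ j))"
    unfolding of_nat_sum[symmetric] of_nat_le_iff .
  also have "\<dots> \<le> (\<Sum>p\<in>{Suc Z..m}. real m * (1 / real p ^ j))"
    by (intro sum_mono) (simp add: of_nat_div_le_of_nat flip: of_nat_power)
  also have "\<dots> \<le> real m * (1 / real Z)"
    unfolding sum_distrib_left[symmetric]
    by (intro mult_left_mono sum_inverse_power_tail_le assms) auto
  finally show ?thesis by simp
qed

text \<open>The difference of squares is at most \<open>2 * C * H\<close> times the difference of
  the windows, and the latter is at most \<open>2 * C\<close> times the number of bad integers in
  the window. Each shift meets bad integers with density at most \<open>\<delta>\<close>.\<close>

lemma window_mean_diff_le: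
  assumes C: "\<And>k. k > 0 \<Longrightarrow> cmod (f k) \<le> C" "\<And>k. k > 0 \<Longrightarrow> cmod (b k) \<le> C"
    and Bad: "\<And>k. k > 0 \<Longrightarrow> f k \<noteq> b k \<Longrightarrow> k \<in> Bad"
    and \<delta>: "\<And>m. real (card {k \<in> {1..m}. k \<in> Bad}) \<le> real m * \<delta>"
    and x: "x \<ge> 1" "x \<ge> real H"
  shows "\<bar>window_mean f H x - window_mean b H x\<bar> \<le> 8 * C\<^sup>2 * (real H)\<^sup>2 * \<delta>"
proof -
  define m where "m = nat \<lfloor>x\<rfloor>"
  have m: "real m \<le> x" unfolding m_def using x by linarith
  have "C \<ge> 0" using order_trans[OF norm_ge_zero C(1)[of 1]] by simp
  have "\<delta> \<ge> 0" using order_trans[OF of_nat_0_le_iff \<delta>[of 1]] by simp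
  have W: "cmod (window g H n) \<le> C * real H" if "\<And>k. k > 0 \<Longrightarrow> cmod (g k) \<le> C" for g n
  proof -
    have "cmod (window g H n) \<le> (\<Sum>h<H. cmod (g (n + Suc h)))"
      unfolding window_conv_lessThan by (rule norm_sum)
    also have "\<dots> \<le> real (card {..<H}) * C"
      by (rule sum_bounded_above) (simp add: that)
    finally show ?thesis by (simp add: mult.commute)
  qed
  have diff: "\<bar>(cmod (window f H n))\<^sup>2 - (cmod (window b H n))\<^sup>2\<bar> \<le>
      2 * C * real H * (\<Sum>h<H. 2 * C * of_bool (n + Suc h \<in> Bad))" for n
  proof -
    have "\<bar>(cmod (window f H n))\<^sup>2 - (cmod (window b H n))\<^sup>2\<bar> =
        \<bar>cmod (window f H n) + cmod (window b H n)\<bar> * \<bar>cmod (window f H n) - cmod (window b H n)\<bar>"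
      by (simp add: power2_eq_square square_diff_square_factored abs_mult)
    also have "\<dots> \<le> (2 * C * real H) * cmod (window f H n - window b H n)"
      using W[of f n] W[of b n] C \<open>C \<ge> 0\<close>
      by (intro mult_mono norm_triangle_ineq3) auto
    also have "cmod (window f H n - window b H n) \<le> (\<Sum>h<H. cmod (f (n + Suc h) - b (n + Suc h)))"
      unfolding window_conv_lessThan sum_subtractf[symmetric] by (rule norm_sum)
    also have "\<dots> \<le> (\<Sum>h<H. 2 * C * of_bool (n + Suc h \<in> Bad))"
    proof (rule sum_mono)
      fix h
      show "cmod (f (n + Suc h) - b (n + Suc h)) \<le> 2 * C * of_bool (n + Suc h \<in> Bad)"
        using Bad[of "n + Suc h"] C[of "n + Suc h"] norm_triangle_ineq4[of "f (n + Suc h)" "b (n + Suc h)"]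
        by (cases "f (n + Suc h) = b (n + Suc h)") (use \<open>C \<ge> 0\<close> in auto)
    qed
    finally show ?thesis using \<open>C \<ge> 0\<close> by (simp add: mult_left_mono)
  qed
  \<comment> \<open>Shifting by at most \<open>H\<close> keeps the arguments below
    \<open>m + H\<close>.\<close>
  have count: "(\<Sum>n = 1..m. of_bool (n + Suc h \<in> Bad)) \<le> real (m + H) * \<delta>" if "h < H" for h
  proof -
    have "(\<Sum>n = 1..m. of_bool (n + Suc h \<in> Bad)) = real (card {n \<in> {1..m}. n + Suc h \<in> Bad})"
      by (simp add: sum_of_bool_eq Int_def)
    also have "card {n \<in> {1..m}. n + Suc h \<in> Bad} = card ((\<lambda>n. n + Suc h) ` {n \<in> {1..m}. n + Suc h \<in> Bad})"
      by (rule card_image[symmetric]) (simp add: inj_on_def)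
    also have "\<dots> \<le> card {k \<in> {1..m + H}. k \<in> Bad}"
      using that by (intro card_mono) auto
    finally show ?thesis using \<delta>[of "m + H"] by simp
  qed
  have "\<bar>window_mean f H x - window_mean b H x\<bar> =
      1 / x * \<bar>\<Sum>n = 1..m. (cmod (window f H n))\<^sup>2 - (cmod (window b H n))\<^sup>2\<bar>"
    using x unfolding window_mean_def window_def[symmetric] m_def[symmetric] sum_subtractf right_diff_distrib[symmetric] abs_mult
    by simp
  also have "\<dots> \<le> 1 / x * (\<Sum>n = 1..m. 2 * C * real H * (\<Sum>h<H. 2 * C * of_bool (n + Suc h \<in> Bad)))"
    using x by (intro mult_left_mono order_trans[OF sum_abs] sum_mono diff) auto
  also have "(\<Sum>n = 1..m. 2 * C * real H * (\<Sum>h<H. 2 * C * of_bool (n + Suc h \<in> Bad))) =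
      2 * C * real H * (2 * C * (\<Sum>h<H. \<Sum>n = 1..m. of_bool (n + Suc h \<in> Bad)))"
    unfolding sum_distrib_left[symmetric] by (subst sum.swap) simp
  also have "1 / x * \<dots> \<le> 1 / x * (2 * C * real H * (2 * C * (\<Sum>h<H. real (m + H) * \<delta>)))"
    using x \<open>C \<ge> 0\<close> by (intro mult_left_mono sum_mono count) auto
  also have "\<dots> = 4 * C\<^sup>2 * (real H)\<^sup>2 * \<delta> * (real (m + H) / x)"
    by (simp add: power2_eq_square)
  \<comment> \<open>Both \<open>m\<close> and \<open>H\<close> are at most \<open>x\<close>, which
    costs the factor 2.\<close>
  also have "\<dots> \<le> 4 * C\<^sup>2 * (real H)\<^sup>2 * \<delta> * 2"
    using m x \<open>\<delta> \<ge> 0\<close> by (intro mult_left_mono) (auto simp: field_simps)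
  finally show ?thesis by simp
qed

section \<open>Sieving by finitely many primes as a combination of dilates\<close>

context nonprincipal_character
begin

text \<open>By coprimality both conditions say \<open>k = D * E * e\<close>, and then
  \<open>\<chi> (E * e) = \<chi> E * \<chi> e\<close>.\<close>

lemma dilate_restrict:
  assumes "coprime D E" "D > 0" "E > 0"
  shows "of_bool (E dvd k) * dilate \<chi> D k = \<chi> E * dilate \<chi> (D * E) k"
proof (cases "D * E dvd k")
  case True
  then obtain e where "k = D * E * e" by blast
  then have k: "k = D * (E * e)" by (simp add: mult.assoc)
  have "dilate \<chi> D k = \<chi> E * \<chi> e" using assms(2) by (simp add: k dilate_def chi_mult)
  moreover have "dilate \<chi> (D * E) k = \<chi> e" using assms by (simp add: k dilate_def)
  ultimately show ?thesis by (simp add: k)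
next
  case False
  then have "\<not> (D dvd k \<and> E dvd k)" using divides_mult[OF _ _ assms(1)] by blast
  with False show ?thesis by (auto simp: dilate_def)
qed

text \<open>Inclusion-exclusion over \<open>P\<close>, with weights of the shape mu(d) chi(d^j);
  only their size is recorded. Quantifying over \<open>r\<close> inside lets one choice of
  \<open>\<D>\<close> and \<open>c\<close> serve every ramified part.\<close>

definition sieve_weights :: "nat set \<Rightarrow> nat \<Rightarrow> nat set \<Rightarrow> (nat \<Rightarrow> complex) \<Rightarrow> bool" where
  "sieve_weights P j \<D> c \<longleftrightarrow> finite \<D> \<and>
    (\<forall>d\<in>\<D>. d > 0 \<and> (\<forall>p. prime p \<longrightarrow> p dvd d \<longrightarrow> p \<in> P) \<and> cmod (c d) \<le> 1) \<and>
    (\<forall>r>0. (\<forall>p\<in>P. \<not> p dvd r) \<longrightarrow>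
      (\<forall>k. of_bool (\<forall>p\<in>P. \<not> p ^ j dvd k) * dilate \<chi> r k = (\<Sum>d\<in>\<D>. c d * dilate \<chi> (r * d ^ j) k)))"

text \<open>A new prime \<open>p\<close> multiplies the indicator by one minus the indicator of
  \<open>p ^ j dvd k\<close>. By \<open>dilate_restrict\<close> the second term replaces
  \<open>d\<close> by \<open>p * d\<close>, with weight \<open>- \<chi> (p ^ j)\<close>.\<close>

lemma sieve_weights_exist:
  assumes "finite P" "\<And>p. p \<in> P \<Longrightarrow> prime p"
  shows "\<exists>\<D> c. sieve_weights P j \<D> c"
  using assms
proof (induction P rule: finite_induct)
  case empty
  have "sieve_weights {} j {1} (\<lambda>_. 1)" by (auto simp: sieve_weights_def)
  then show ?case by blast
next
  case (insert p P)
  have p: "prime p" "p > 0" using insert.prems prime_gt_0_nat by auto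
  obtain \<D> c where "sieve_weights P j \<D> c"
    using insert.IH insert.prems by auto
  then have fin: "finite \<D>"
    and \<D>: "\<And>d. d \<in> \<D> \<Longrightarrow> d > 0" "\<And>d s. d \<in> \<D> \<Longrightarrow> prime s \<Longrightarrow> s dvd d \<Longrightarrow> s \<in> P"
      "\<And>d. d \<in> \<D> \<Longrightarrow> cmod (c d) \<le> 1"
    and exp: "\<And>r k. r > 0 \<Longrightarrow> \<forall>p\<in>P. \<not> p dvd r \<Longrightarrow>
      of_bool (\<forall>p\<in>P. \<not> p ^ j dvd k) * dilate \<chi> r k = (\<Sum>d\<in>\<D>. c d * dilate \<chi> (r * d ^ j) k)"
    by (simp_all only: sieve_weights_def)
  have p_ndvd: "\<not> p dvd d" if "d \<in> \<D>" for d
    using \<D>(2)[OF that p(1)] insert.hyps(2) by blast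
  define \<D>' where "\<D>' = \<D> \<union> (\<lambda>d. p * d) ` \<D>"
  \<comment> \<open>No old \<open>d\<close> is divisible by \<open>p\<close>, so divisibility by
    \<open>p\<close> tells the two kinds of indices apart and \<open>n div p\<close> recovers the
    old one.\<close>
  define c' where "c' n = (if p dvd n then - (\<chi> (p ^ j) * c (n div p)) else c n)" for n
  have "finite \<D>'" using fin by (simp add: \<D>'_def)
  moreover have "d > 0 \<and> (\<forall>s. prime s \<longrightarrow> s dvd d \<longrightarrow> s \<in> insert p P) \<and> cmod (c' d) \<le> 1"
    if "d \<in> \<D>'" for d
  proof (cases "d \<in> \<D>")
    case True
    then show ?thesis using \<D> p_ndvd by (auto simp: c'_def)
  next
    case False
    then obtain e where e: "e \<in> \<D>" "d = p * e" using \<open>d \<in> \<D>'\<close> by (auto simp: \<D>'_def)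
    have "cmod (c' d) \<le> 1"
      using norm_chi_le_1[of "p ^ j"] \<D>(3)[OF e(1)] p(2)
      by (simp add: c'_def e norm_mult mult_le_one)
    moreover have "s \<in> insert p P" if "prime s" "s dvd d" for s
      using that \<D>(2)[OF e(1)] p(1) by (auto simp: e prime_dvd_mult_iff primes_dvd_imp_eq)
    ultimately show ?thesis using \<D>(1)[OF e(1)] p(2) by (auto simp: e)
  qed
  moreover have "of_bool (\<forall>p\<in>insert p P. \<not> p ^ j dvd k) * dilate \<chi> r k =
      (\<Sum>d\<in>\<D>'. c' d * dilate \<chi> (r * d ^ j) k)"
    if r: "r > 0" "\<forall>p\<in>insert p P. \<not> p dvd r" for r k
  proof -
    have disj: "\<D> \<inter> (\<lambda>d. p * d) ` \<D> = {}" using p_ndvd dvd_triv_left[of p] by blast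
    have inj: "inj_on (\<lambda>d. p * d) \<D>" using p(2) by (auto simp: inj_on_def)
    have summand: "c' (p * d) * dilate \<chi> (r * (p * d) ^ j) k =
        - (of_bool (p ^ j dvd k) * (c d * dilate \<chi> (r * d ^ j) k))" if d: "d \<in> \<D>" for d
    proof -
      have "coprime p r" "coprime p d"
        using r p_ndvd[OF d] p(1) by (auto intro: prime_imp_coprime)
      then have "coprime (r * d ^ j) (p ^ j)" by (simp add: coprime_commute)
      then have "of_bool (p ^ j dvd k) * dilate \<chi> (r * d ^ j) k =
          \<chi> (p ^ j) * dilate \<chi> (r * d ^ j * p ^ j) k"
        using r p(2) \<D>(1)[OF d] by (intro dilate_restrict) auto
      moreover have "c' (p * d) = - (\<chi> (p ^ j) * c d)" using p(2) by (simp add: c'_def)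
      ultimately show ?thesis by (simp add: power_mult_distrib mult_ac)
    qed
    have "(\<Sum>d\<in>\<D>'. c' d * dilate \<chi> (r * d ^ j) k) =
        (\<Sum>d\<in>\<D>. c' d * dilate \<chi> (r * d ^ j) k) + (\<Sum>d\<in>\<D>. c' (p * d) * dilate \<chi> (r * (p * d) ^ j) k)"
      unfolding \<D>'_def using fin disj by (simp add: sum.union_disjoint sum.reindex[OF inj])
    also have "(\<Sum>d\<in>\<D>. c' d * dilate \<chi> (r * d ^ j) k) = (\<Sum>d\<in>\<D>. c d * dilate \<chi> (r * d ^ j) k)"
      using p_ndvd by (intro sum.cong) (auto simp: c'_def)
    also have "(\<Sum>d\<in>\<D>. c' (p * d) * dilate \<chi> (r * (p * d) ^ j) k) =
        - (of_bool (p ^ j dvd k) * (\<Sum>d\<in>\<D>. c d * dilate \<chi> (r * d ^ j) k))"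
      by (simp add: summand sum_distrib_left sum_negf)
    finally show ?thesis
      using exp[of r k, symmetric] r by auto
  qed
  ultimately have "sieve_weights (insert p P) j \<D>' c'"
    unfolding sieve_weights_def by simp
  then show ?case by blast
qed

end

section \<open>The extended character on power-free integers\<close>

locale character_extension = nonprincipal_character +
  fixes \<chi>s :: "nat \<Rightarrow> complex" and j :: nat
  assumes multiplicative: "completely_multiplicative \<chi>s"
    and extends: "n > 0 \<Longrightarrow> coprime n q \<Longrightarrow> \<chi>s n = \<chi> n"
    and j_ge_2: "j \<ge> 2"
begin

text \<open>The possible parts of a \<open>j\<close>-free integer composed of primes dividing \<open>q\<close>.\<close>

definition ramified :: "nat set" where
  "ramified = {r. r dvd q ^ (j - 1) \<and> powerfree j r}"

lemma finite_ramified: "finite ramified"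
proof -
  have "finite {r. r dvd q ^ (j - 1)}" using q_pos by (intro finite_divisors_nat) auto
  then show ?thesis by (rule rev_finite_subset) (auto simp: ramified_def)
qed

lemma ramified_pos: "r \<in> ramified \<Longrightarrow> r > 0"
  using q_pos by (auto simp: ramified_def intro: Nat.gr0I)

lemma ramified_prime_dvd: "r \<in> ramified \<Longrightarrow> prime p \<Longrightarrow> p dvd r \<Longrightarrow> p dvd q"
  using dvd_trans[of p r "q ^ (j - 1)"] prime_dvd_power[of p q "j - 1"]
  by (simp add: ramified_def)

text \<open>Write \<open>k = r0 * m\<close> with \<open>m\<close> coprime to \<open>q\<close> and
  all primes of \<open>r0\<close> dividing \<open>q\<close>. A dilate is nonzero at \<open>k\<close>
  only if \<open>k div r\<close> is coprime to \<open>q\<close>, which forces \<open>r = r0\<close>;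
  so a single term survives, and only when \<open>r0\<close> is \<open>j\<close>-free.\<close>

lemma ramified_expansion:
  assumes "k > 0"
  shows "(\<Sum>r\<in>ramified. \<chi>s r * dilate \<chi> r k) =
    of_bool (\<forall>p. prime p \<and> p dvd q \<longrightarrow> \<not> p ^ j dvd k) * \<chi>s k"
proof -
  obtain r0 m where k: "k = r0 * m" and m: "coprime m q"
    and r0: "\<And>p. prime p \<Longrightarrow> p dvd r0 \<Longrightarrow> p dvd q"
    using smooth_coprime_decomposition[OF assms, of q] by blast
  have pos: "r0 > 0" "m > 0" using assms k by auto
  have dilate: "dilate \<chi> r k = (if r = r0 then \<chi> m else 0)" if r: "r \<in> ramified" for r
  proof (cases "r dvd k \<and> coprime (k div r) q")
    case True
    then obtain n where n: "k = r * n" "coprime n q"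
      using ramified_pos[OF r] by (auto elim!: dvdE)
    have "coprime r m" "coprime r0 n"
      using coprime_if_prime_divisors[OF ramified_prime_dvd[OF r] m]
        coprime_if_prime_divisors[OF r0 n(2)] by auto
    moreover have "r dvd r0 * m" "r0 dvd r * n" using n(1) k by (metis dvd_triv_left)+
    ultimately have "r dvd r0" "r0 dvd r" by (simp_all add: coprime_dvd_mult_left_iff)
    then have "r = r0" by (rule dvd_antisym)
    then show ?thesis using pos by (simp add: dilate_def k)
  next
    case False
    then have "dilate \<chi> r k = 0" by (auto simp: dilate_def chi_eq_0_iff)
    moreover have "r \<noteq> r0" using False m pos by (auto simp: k)
    ultimately show ?thesis by simp
  qed
  have r0_ramified: "r0 \<in> ramified \<longleftrightarrow> (\<forall>p. prime p \<and> p dvd q \<longrightarrow> \<not> p ^ j dvd k)"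
  proof (intro iffI allI impI notI)
    fix p assume *: "r0 \<in> ramified" "prime p \<and> p dvd q" "p ^ j dvd k"
    have "coprime (p ^ j) m"
    proof (rule coprime_if_prime_divisors[OF _ m])
      fix s assume "prime s" "s dvd p ^ j"
      then have "s dvd p" by (rule prime_dvd_power)
      with * show "s dvd q" using dvd_trans[of s p q] by simp
    qed
    then have "p ^ j dvd r0" using *(3) by (simp add: k coprime_dvd_mult_left_iff)
    then show False using * by (auto simp: ramified_def powerfree_def)
  next
    assume *: "\<forall>p. prime p \<and> p dvd q \<longrightarrow> \<not> p ^ j dvd k"
    have "powerfree j r0"
      unfolding powerfree_def
    proof (intro allI impI notI)
      fix p assume p: "prime p" "p ^ j dvd r0"
      have "p dvd p ^ j" using j_ge_2 by (intro dvd_power) auto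
      then have "p dvd q" using r0 p dvd_trans by blast
      with * p show False by (auto simp: k)
    qed
    then show "r0 \<in> ramified"
      using powerfree_smooth_dvd[of j r0 q] j_ge_2 pos r0 q_pos by (auto simp: ramified_def)
  qed
  have "(\<Sum>r\<in>ramified. \<chi>s r * dilate \<chi> r k) = (\<Sum>r\<in>ramified. if r = r0 then \<chi>s r0 * \<chi> m else 0)"
    by (intro sum.cong) (auto simp: dilate)
  also have "\<dots> = of_bool (r0 \<in> ramified) * (\<chi>s r0 * \<chi>s m)"
    using finite_ramified extends[OF pos(2) m] by simp
  also have "\<chi>s r0 * \<chi>s m = \<chi>s k"
    using multiplicative pos by (simp add: completely_multiplicative_def k)
  finally show ?thesis by (simp add: r0_ramified)
qed

text \<open>Primes dividing \<open>q\<close> are treated exactly by the sum over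
  \<open>ramified\<close>, so truncation at \<open>Z\<close> affects only the remaining
  primes.\<close>

definition approximant :: "nat \<Rightarrow> nat \<Rightarrow> complex" where
  "approximant Z k = of_bool (\<forall>p\<in>{p. prime p \<and> p \<le> Z \<and> \<not> p dvd q}. \<not> p ^ j dvd k) *
     (\<Sum>r\<in>ramified. \<chi>s r * dilate \<chi> r k)"

lemma norm_approximant_le: "cmod (approximant Z k) \<le> (\<Sum>r\<in>ramified. cmod (\<chi>s r))"
proof -
  have "cmod (approximant Z k) \<le> cmod (\<Sum>r\<in>ramified. \<chi>s r * dilate \<chi> r k)"
    by (simp add: approximant_def norm_mult)
  also have "\<dots> \<le> (\<Sum>r\<in>ramified. cmod (\<chi>s r * dilate \<chi> r k))"
    by (rule norm_sum)
  also have "\<dots> \<le> (\<Sum>r\<in>ramified. cmod (\<chi>s r))"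
    using norm_chi_le_1 by (intro sum_mono) (simp add: norm_mult dilate_def mult_left_le)
  finally show ?thesis .
qed

lemma powerfree_eq_approximant:
  assumes "k > 0" "\<And>p. prime p \<Longrightarrow> p > Z \<Longrightarrow> \<not> p ^ j dvd k"
  shows "of_bool (powerfree j k) * \<chi>s k = approximant Z k"
proof -
  have "powerfree j k \<longleftrightarrow> (\<forall>p\<in>{p. prime p \<and> p \<le> Z \<and> \<not> p dvd q}. \<not> p ^ j dvd k) \<and>
      (\<forall>p. prime p \<and> p dvd q \<longrightarrow> \<not> p ^ j dvd k)"
    unfolding powerfree_def mem_Collect_eq Ball_def using assms(2) not_le by blast
  then show ?thesis by (simp add: approximant_def ramified_expansion[OF assms(1)])
qed

text \<open>At level \<open>Z = k\<close> the approximant is exact, because \<open>p > k\<close>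
  implies \<open>p ^ j > k\<close>. Its bound, which does not involve \<open>Z\<close>, therefore
  carries over.\<close>

lemma norm_powerfree_le:
  assumes "k > 0"
  shows "cmod (of_bool (powerfree j k) * \<chi>s k) \<le> (\<Sum>r\<in>ramified. cmod (\<chi>s r))"
proof -
  have "\<not> p ^ j dvd k" if "prime p" "p > k" for p
  proof
    assume "p ^ j dvd k"
    then have "p ^ j \<le> k" using assms by (intro dvd_imp_le) auto
    moreover have "p \<le> p ^ j" using that j_ge_2 by (intro self_le_power) auto
    ultimately show False using that by simp
  qed
  then show ?thesis
    using powerfree_eq_approximant[OF assms, of k] norm_approximant_le[of k k] by simp
qed

text \<open>The factor \<open>12\<close> is \<open>3 * 2\<^sup>2\<close> from \<open>sum_min_power_le\<close> and \<open>sum_inverse_power_le\<close>; the rest is the cost of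
  applying the Cauchy-Schwarz inequality to the sum over \<open>ramified\<close>.\<close>

definition mean_const :: real where
  "mean_const = (\<Sum>r\<in>ramified. (cmod (\<chi>s r))\<^sup>2) * (real (card ramified) * ((real q)\<^sup>2 * 12))"

text \<open>The approximant is periodic, so the limit is an average over one period. Cauchy-Schwarz
  over \<open>ramified\<close> reduces the bound to \<open>mean_square_combination_le\<close> for
  each \<open>r\<close>. The constant does not involve \<open>Z\<close>.\<close>

lemma approximant_mean:
  "\<exists>L. (window_mean (approximant Z) H \<longlongrightarrow> L) at_top \<and> \<bar>L\<bar> \<le> mean_const * real H powr (1 / real j)"
proof -
  define P where "P = {p. prime p \<and> p \<le> Z \<and> \<not> p dvd q}"
  have "finite P" by (rule finite_subset[of _ "{..Z}"]) (auto simp: P_def)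
  moreover have "prime p" if "p \<in> P" for p using that by (simp add: P_def)
  ultimately have "\<exists>\<D> c. sieve_weights P j \<D> c" by (rule sieve_weights_exist)
  then obtain \<D> c where "sieve_weights P j \<D> c" by blast
  then have fin: "finite \<D>"
    and \<D>: "\<And>d. d \<in> \<D> \<Longrightarrow> d > 0" "\<And>d p. d \<in> \<D> \<Longrightarrow> prime p \<Longrightarrow> p dvd d \<Longrightarrow> p \<in> P"
      "\<And>d. d \<in> \<D> \<Longrightarrow> cmod (c d) \<le> 1"
    and exp: "\<And>r k. r > 0 \<Longrightarrow> \<forall>p\<in>P. \<not> p dvd r \<Longrightarrow>
      of_bool (\<forall>p\<in>P. \<not> p ^ j dvd k) * dilate \<chi> r k = (\<Sum>d\<in>\<D>. c d * dilate \<chi> (r * d ^ j) k)"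
    by (simp_all only: sieve_weights_def)
  have cop: "coprime d q" if "d \<in> \<D>" for d
  proof (rule ccontr)
    assume "\<not> coprime d q"
    then obtain p where "prime p" "p dvd d" "p dvd q" by (rule not_coprime_common_prime)
    then show False using \<D>(2)[OF that] by (auto simp: P_def)
  qed
  \<comment> \<open>The product over \<open>\<D>\<close> occurs twice so that
    \<open>d ^ j * e ^ j\<close> divides it for every pair, including \<open>d = e\<close>.\<close>
  define N where "N = \<Prod>ramified * q * ((\<Prod>d\<in>\<D>. d ^ j) * (\<Prod>d\<in>\<D>. d ^ j))"
  have "N > 0"
    unfolding N_def using ramified_pos q_pos \<D>(1) by (auto intro!: prod_pos)
  have N: "r * q * (d ^ j * e ^ j) dvd N" if "r \<in> ramified" "d \<in> \<D>" "e \<in> \<D>" for r d e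
    unfolding N_def using that fin finite_ramified
    by (intro mult_dvd_mono dvd_refl dvd_prodI[of _ _ "\<lambda>d. d ^ j"] dvd_prodI[of _ _ "\<lambda>r. r"]) auto
  have approx: "approximant Z = (\<lambda>k. \<Sum>r\<in>ramified. \<chi>s r * (\<Sum>d\<in>\<D>. c d * dilate \<chi> (r * d ^ j) k))"
  proof
    fix k
    have "of_bool (\<forall>p\<in>P. \<not> p ^ j dvd k) * dilate \<chi> r k = (\<Sum>d\<in>\<D>. c d * dilate \<chi> (r * d ^ j) k)"
      if "r \<in> ramified" for r
      using that ramified_pos ramified_prime_dvd by (intro exp) (auto simp: P_def)
    moreover have "approximant Z k =
        (\<Sum>r\<in>ramified. \<chi>s r * (of_bool (\<forall>p\<in>P. \<not> p ^ j dvd k) * dilate \<chi> r k))"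
      unfolding approximant_def P_def[symmetric] sum_distrib_left by (simp add: mult_ac)
    ultimately show "approximant Z k = (\<Sum>r\<in>ramified. \<chi>s r * (\<Sum>d\<in>\<D>. c d * dilate \<chi> (r * d ^ j) k))"
      by simp
  qed
  define Y where "Y r n = (\<Sum>d\<in>\<D>. c d * window (dilate \<chi> (r * d ^ j)) H n)" for r n
  have window_approx: "window (approximant Z) H n = (\<Sum>r\<in>ramified. \<chi>s r * Y r n)" for n
  proof -
    have "window (approximant Z) H n =
        (\<Sum>h<H. \<Sum>r\<in>ramified. \<Sum>d\<in>\<D>. \<chi>s r * (c d * dilate \<chi> (r * d ^ j) (n + Suc h)))"
      by (simp add: approx window_conv_lessThan sum_distrib_left)
    also have "\<dots> = (\<Sum>r\<in>ramified. \<Sum>d\<in>\<D>. \<Sum>h<H. \<chi>s r * (c d * dilate \<chi> (r * d ^ j) (n + Suc h)))"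
      by (subst sum.swap, rule sum.cong[OF refl], subst sum.swap) simp
    finally show ?thesis by (simp add: Y_def window_conv_lessThan sum_distrib_left)
  qed
  have "periodic N (dilate \<chi> (r * d ^ j))" if "r \<in> ramified" "d \<in> \<D>" for r d
  proof (rule periodic_dvd[OF periodic_dilate[OF periodic_chi]])
    show "r * d ^ j > 0" using that ramified_pos \<D>(1) by simp
    show "r * d ^ j * q dvd N"
      using N[OF that(1) that(2) that(2)] by (rule dvd_trans[rotated]) (simp add: mult_ac)
  qed
  then have "periodic N (approximant Z)"
    unfolding approx periodic_def by simp
  then have "periodic N (\<lambda>n. (cmod (window (approximant Z) H n))\<^sup>2)"
    using periodic_window[of N "approximant Z" H] by (simp add: periodic_def)
  from periodic_mean[OF this \<open>N > 0\<close>]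
  have lim: "(window_mean (approximant Z) H \<longlongrightarrow>
      (\<Sum>n<N. (cmod (window (approximant Z) H n))\<^sup>2) / real N) at_top"
    by (simp add: window_mean_def[abs_def] window_def)
  have "(\<Sum>n<N. (cmod (window (approximant Z) H n))\<^sup>2) \<le> real N * (mean_const * real H powr (1 / real j))"
  proof (cases "H = 0")
    case False
    \<comment> \<open>The bound \<open>y \<ge> 1\<close> needs \<open>H > 0\<close>; for
      \<open>H = 0\<close> the windows are empty.\<close>
    define y where "y = real H powr (1 / real j)"
    have y: "y \<ge> 1" "y ^ j = real H"
      using False j_ge_2 by (auto simp: y_def ge_one_powr_ge_zero powr_power)
    have mean: "(\<Sum>n<N. (cmod (Y r n))\<^sup>2) \<le> real N * (real q)\<^sup>2 * (12 * y)" if "r \<in> ramified" for r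
      unfolding Y_def using that ramified_pos \<D> cop fin j_ge_2 y
      by (intro mean_square_combination_le N) auto
    have "(cmod (window (approximant Z) H n))\<^sup>2 \<le>
        (\<Sum>r\<in>ramified. (cmod (\<chi>s r))\<^sup>2) * (\<Sum>r\<in>ramified. (cmod (Y r n))\<^sup>2)" for n
    proof -
      have "cmod (window (approximant Z) H n) \<le> (\<Sum>r\<in>ramified. cmod (\<chi>s r) * cmod (Y r n))"
        unfolding window_approx norm_mult[symmetric] by (rule norm_sum)
      then have "(cmod (window (approximant Z) H n))\<^sup>2 \<le> (\<Sum>r\<in>ramified. cmod (\<chi>s r) * cmod (Y r n))\<^sup>2"
        by (rule power_mono) simp
      also have "\<dots> \<le> (\<Sum>r\<in>ramified. (cmod (\<chi>s r))\<^sup>2) * (\<Sum>r\<in>ramified. (cmod (Y r n))\<^sup>2)"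
        by (rule Cauchy_Schwarz_ineq_sum)
      finally show ?thesis .
    qed
    then have "(\<Sum>n<N. (cmod (window (approximant Z) H n))\<^sup>2) \<le>
        (\<Sum>n<N. (\<Sum>r\<in>ramified. (cmod (\<chi>s r))\<^sup>2) * (\<Sum>r\<in>ramified. (cmod (Y r n))\<^sup>2))"
      by (rule sum_mono)
    also have "\<dots> = (\<Sum>r\<in>ramified. (cmod (\<chi>s r))\<^sup>2) * (\<Sum>r\<in>ramified. \<Sum>n<N. (cmod (Y r n))\<^sup>2)"
      unfolding sum_distrib_left[symmetric] by (subst sum.swap) simp
    also have "\<dots> \<le> (\<Sum>r\<in>ramified. (cmod (\<chi>s r))\<^sup>2) * (\<Sum>r\<in>ramified. real N * (real q)\<^sup>2 * (12 * y))"
      by (intro mult_left_mono sum_mono mean sum_nonneg) auto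
    also have "\<dots> = real N * (mean_const * y)"
      by (simp add: mean_const_def)
    finally show ?thesis by (simp add: y_def)
  qed (simp add: window_def)
  then have "(\<Sum>n<N. (cmod (window (approximant Z) H n))\<^sup>2) / real N \<le> mean_const * real H powr (1 / real j)"
    using \<open>N > 0\<close> by (simp add: divide_le_eq mult.commute)
  moreover have "(\<Sum>n<N. (cmod (window (approximant Z) H n))\<^sup>2) / real N \<ge> 0"
    by (intro divide_nonneg_nonneg sum_nonneg) auto
  ultimately show ?thesis using lim by (intro exI conjI) auto
qed

text \<open>For fixed \<open>H\<close> the approximants are close in mean square as \<open>Z\<close>
  grows, and their limits share one bound, so \<open>approximable_limit\<close> applies.\<close>

lemma powerfree_mean:
  obtains L where "(window_mean (\<lambda>k. of_bool (powerfree j k) * \<chi>s k) H \<longlongrightarrow> L) at_top"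
    "\<bar>L\<bar> \<le> mean_const * real H powr (1 / real j)"
proof (rule approximable_limit)
  fix \<epsilon> :: real assume \<epsilon>: "\<epsilon> > 0"
  let ?f = "\<lambda>k. of_bool (powerfree j k) * \<chi>s k"
  define C where "C = (\<Sum>r\<in>ramified. cmod (\<chi>s r))"
  define A where "A = 8 * C\<^sup>2 * (real H)\<^sup>2"
  \<comment> \<open>Makes the error \<open>A / Z\<close> at most \<open>\<epsilon>\<close>;
    \<open>Suc\<close> ensures \<open>Z \<ge> 1\<close> even if \<open>A = 0\<close>. The dependence
    on \<open>H\<close> is harmless because the bound is uniform in \<open>Z\<close>.\<close>
  define Z where "Z = Suc (nat \<lceil>A / \<epsilon>\<rceil>)"
  have "A / \<epsilon> \<le> real Z" unfolding Z_def by linarith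
  then have Z: "A * (1 / real Z) \<le> \<epsilon>" "Z \<ge> 1"
    using \<epsilon> by (auto simp: Z_def field_simps)
  have "\<bar>window_mean ?f H x - window_mean (approximant Z) H x\<bar> \<le> \<epsilon>" if "x \<ge> 1" "x \<ge> real H" for x
  proof -
    have "\<bar>window_mean ?f H x - window_mean (approximant Z) H x\<bar> \<le> A * (1 / real Z)"
      unfolding A_def
    proof (rule window_mean_diff_le[where Bad = "{k. \<exists>p>Z. p ^ j dvd k}"])
      show "cmod (?f k) \<le> C" if "k > 0" for k
        using norm_powerfree_le[OF that] by (simp add: C_def)
      show "cmod (approximant Z k) \<le> C" for k
        using norm_approximant_le by (simp add: C_def)
      show "k \<in> {k. \<exists>p>Z. p ^ j dvd k}" if "k > 0" "?f k \<noteq> approximant Z k" for k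
        using powerfree_eq_approximant[OF that(1), of Z] that(2) by blast
      show "real (card {k \<in> {1..m}. k \<in> {k. \<exists>p>Z. p ^ j dvd k}}) \<le> real m * (1 / real Z)" for m
        using card_large_power_divisors_le[OF j_ge_2 Z(2), of m] by simp
    qed (use that in auto)
    with Z(1) show ?thesis by linarith
  qed
  then have "\<forall>\<^sub>F x in at_top. \<bar>window_mean ?f H x - window_mean (approximant Z) H x\<bar> \<le> \<epsilon>"
    using eventually_ge_at_top[of "max 1 (real H)"] by (auto elim!: eventually_mono)
  then show "\<exists>v L. (v \<longlongrightarrow> L) at_top \<and> \<bar>L\<bar> \<le> mean_const * real H powr (1 / real j) \<and>
      (\<forall>\<^sub>F x in at_top. \<bar>window_mean ?f H x - v x\<bar> \<le> \<epsilon>)"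
    using approximant_mean[of Z H] by blast
qed

lemma Lambda_powerfree:
  fixes f :: "nat \<Rightarrow> complex"
  assumes f: "\<And>k. k > 0 \<Longrightarrow> f k = of_bool (powerfree j k) * \<chi>s k"
  shows "(\<forall>H. (window_mean f H \<longlongrightarrow> Lambda f H) at_top) \<and>
    (\<exists>c>0. \<forall>H. \<bar>Lambda f H\<bar> \<le> c * real H powr (1 / real j))"
proof -
  let ?g = "\<lambda>k. of_bool (powerfree j k) * \<chi>s k"
  \<comment> \<open>Windows start at \<open>n + 1\<close>, so the value at 0 never enters.\<close>
  have eq: "window_mean f H = window_mean ?g H" for H
    unfolding window_mean_def by (intro ext arg_cong2[of _ _ _ _ "(*)"] sum.cong arg_cong[of _ _ "\<lambda>z. (cmod z)\<^sup>2"] refl) (simp add: f)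
  have *: "(window_mean f H \<longlongrightarrow> Lambda f H) at_top \<and> \<bar>Lambda f H\<bar> \<le> mean_const * real H powr (1 / real j)" for H
  proof -
    obtain L where L: "(window_mean ?g H \<longlongrightarrow> L) at_top" "\<bar>L\<bar> \<le> mean_const * real H powr (1 / real j)"
      by (rule powerfree_mean)
    then show ?thesis
      using tendsto_Lim[OF trivial_limit_at_top_linorder L(1)] eq by (simp add: Lambda_def)
  qed
  \<comment> \<open>Adding 1 makes the constant strictly positive.\<close>
  have "\<bar>Lambda f H\<bar> \<le> (mean_const + 1) * real H powr (1 / real j)" for H
    using * by (rule order_trans[OF conjunct2]) (simp add: mult_right_mono)
  moreover have "mean_const + 1 > 0"
    unfolding mean_const_def by (intro add_nonneg_pos mult_nonneg_nonneg sum_nonneg) auto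
  ultimately show ?thesis using * by blast
qed

end

text \<open>At 0 both sides vanish: 0 is not squarefree, and the square of the prime 2 divides it.
  Elsewhere the sign of \<open>moebius_mu\<close> disappears on squaring.\<close>

lemma f1_eq_powerfree: "f1 g k = of_bool (powerfree 2 k) * g k"
proof -
  have "squarefree k \<longleftrightarrow> powerfree 2 k"
    by (cases "k = 0") (auto simp: powerfree_def squarefree_factorial_semiring intro: exI[of _ 2])
  then show ?thesis
    by (simp add: f1_def moebius_mu_def power_mult[symmetric] mult.commute[of _ 2])
qed

lemma f2_eq_powerfree: "f2 g k = of_bool (powerfree 3 k) * g k"
  by (simp add: f2_def cubefree_def powerfree_def)

theorem theorem1p4:
  fixes q :: nat and \<chi> \<chi>s :: "nat \<Rightarrow> complex"
  assumes "primitive_character q \<chi>"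
    and "\<not> principal_character q \<chi>"
    and "\<forall>n. \<chi> n \<in> \<real>"
    and "completely_multiplicative \<chi>s"
    and "\<forall>n>0. coprime n q \<longrightarrow> \<chi>s n = \<chi> n"
    and "\<forall>p. prime p \<and> p dvd q \<longrightarrow> \<chi>s p \<in> {- 1, 1}"
  shows "((\<forall>H. (window_mean (f1 \<chi>s) H \<longlongrightarrow> Lambda (f1 \<chi>s) H) at_top) \<and>
          (\<exists>c>0. \<forall>H. \<bar>Lambda (f1 \<chi>s) H\<bar> \<le> c * real H powr (1 / 2))) \<and>
         ((\<forall>H. (window_mean (f2 \<chi>s) H \<longlongrightarrow> Lambda (f2 \<chi>s) H) at_top) \<and>
          (\<exists>c>0. \<forall>H. \<bar>Lambda (f2 \<chi>s) H\<bar> \<le> c * real H powr (1 / 3)))"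
proof -
  \<comment> \<open>The exponent \<open>1 / real j\<close> becomes \<open>1 / 2\<close> for
    \<open>f1\<close> and \<open>1 / 3\<close> for \<open>f2\<close>.\<close>
  have ext: "character_extension q \<chi> \<chi>s j" if "j \<ge> 2" for j
    using assms that by unfold_locales (auto simp: primitive_character_def)
  interpret squarefree: character_extension q \<chi> \<chi>s 2 by (rule ext) simp
  interpret cubefree: character_extension q \<chi> \<chi>s 3 by (rule ext) simp
  show ?thesis
    using squarefree.Lambda_powerfree[of "f1 \<chi>s"] cubefree.Lambda_powerfree[of "f2 \<chi>s"]
    by (simp add: f1_eq_powerfree f2_eq_powerfree)
qed

end
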